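(* For all integers $n\geq 0$, $d_2(11n+7) \equiv 0 \pmod{11}$.
   Context: For each integer $k\geq 1$, the numbers $d_k(n)$ (the partition numbers obtained by summing the links of $k$-elongated plane partition diamonds of length $n$) are defined by the generating function $\sum_{n\geq 0} d_k(n)q^n = \frac{f_2^k}{f_1^{3k+1}}$, where $f_r = \prod_{i\geq 1}(1-q^{ri})$. *)

theory Defs
  imports "HOL-Computational_Algebra.Formal_Power_Series"
begin

text \<open>Euler product f_r = prod_{i>=1} (1 - q^(r i)) as a formal power series over the
rationals. Its n-th coefficient equals the n-th coefficient of the finite product
prod_{i=1..n} (1 - q^(r i)) (for r >= 1 the remaining factors do not affect degree n).\<close>
definition euler_f :: "nat \<Rightarrow> rat fps" where
  "euler_f r = Abs_fps (\<lambda>n. fps_nth (\<Prod>i\<in>{1..n}. 1 - fps_X ^ (r * i)) n)"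

definition d :: "nat \<Rightarrow> nat \<Rightarrow> rat" where
  "d k n = fps_nth (euler_f 2 ^ k * inverse (euler_f 1 ^ (3 * k + 1))) n"

end

theory Submission
  imports Defs "HOL-Computational_Algebra.Polynomial"
begin

text \<open>
  Since \<open>f\<^sub>1\<^sup>1\<^sup>1 \<equiv> f\<^sub>1\<^sub>1\<close> modulo 11, the generating function \<open>f\<^sub>2\<^sup>2 / f\<^sub>1\<^sup>7\<close> is
  congruent to \<open>f\<^sub>1\<^sup>4 f\<^sub>2\<^sup>2 / f\<^sub>1\<^sub>1\<close>, so it suffices to treat \<open>f\<^sub>1\<^sup>4 f\<^sub>2\<^sup>2\<close>. The 2-dissection
  \<open>\<phi>(-q)\<^sup>2 = \<phi>(q\<^sup>2)\<^sup>2 - 4 q \<psi>(q\<^sup>4)\<^sup>2\<close> turns this product into \<open>A\<^sup>2 - 4 q B\<^sup>2\<close> with the theta series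
  \<open>A = \<Sum> (6 j + 1) q^(2 j (3 j + 1))\<close> and \<open>B = \<Sum> (3 j + 1) q^(2 j (3 j + 2))\<close>, summed over
  all integers \<open>j\<close>. Completing the square, a term of \<open>A\<^sup>2\<close> or \<open>q B\<^sup>2\<close> with exponent \<open>11 n + 7\<close> gives
  a sum of two squares divisible by 11; as \<open>-1\<close> is a non-residue modulo 11, both squares, and
  hence the weights of the term, are divisible by 11.
\<close>

text \<open>Since phi(-q) = f_1^2/f_2, the product f_1^4 f_2^2 equals phi(-q)^2 f_2^4, so A = f_2^2
  phi(q^2) = f_4^5/f_8^2 and B = f_2^2 psi(q^4) = f_2^2 f_8^2/f_4. These two quotients are single
  sums with linear weights by the quintuple product identity, differentiated at a zero. The linear
  weights are essential: they are the very numbers whose squares appear after completing the square.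
  The residue 7 is forced: the two squares for a term of A^2 with exponent N add up to 6 N + 2,
  which is divisible by 11 exactly for N congruent to 7. The obstacle is that the triple and
  quintuple products live in two variables z and q, whereas the series here have only q. Hence the
  triple product is proved only at z = 1 or -1 times a power of q, as the limit of a finite
  q-binomial identity. Differentiation in z happens once, on polynomials, and yields Jacobi's series
  for f^3. The quintuple identities follow by multiplying that series by phi(-q) and regrouping a
  double sum.\<close>

unbundle fps_syntax

section \<open>Series indexed by an exponent function\<close>

text \<open>The index type is left open so that single theta series (over \<open>int\<close>) and
  their products (over pairs) are objects of one kind, and changes of summation variable become
  reindexings. A sum over an infinite fibre would silently be 0; \<open>proper\<close> excludes this
  and negative exponents.\<close>

definition exp_series :: "('a \<Rightarrow> rat) \<Rightarrow> ('a \<Rightarrow> int) \<Rightarrow> rat fps" where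
  "exp_series w e = Abs_fps (\<lambda>n. \<Sum>k | e k = int n. w k)"

definition proper :: "('a \<Rightarrow> int) \<Rightarrow> bool" where
  "proper e \<longleftrightarrow> (\<forall>k. 0 \<le> e k) \<and> (\<forall>n. finite {k. e k = n})"

lemma exp_series_nth: "exp_series w e $ n = (\<Sum>k | e k = int n. w k)"
  by (simp add: exp_series_def)

lemma exp_series_cong:
  assumes "\<And>k. w k = w' k" "\<And>k. e k = e' k"
  shows "exp_series w e = exp_series w' e'"
  using assms by (metis ext)

text \<open>Linear growth bounds each fibre. The slack of 1 is needed for \<open>tri\<close>, which
  vanishes at 1.\<close>

lemma proper_int:
  fixes e :: "int \<Rightarrow> int"
  assumes "\<And>k. \<bar>k\<bar> - 1 \<le> e k" "\<And>k. 0 \<le> e k"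
  shows "proper e"
  unfolding proper_def
proof (intro conjI allI)
  fix n
  have "{k. e k = n} \<subseteq> {- (n + 1)..n + 1}"
  proof
    fix k assume "k \<in> {k. e k = n}"
    then show "k \<in> {- (n + 1)..n + 1}"
      using assms(1)[of k] by auto
  qed
  then show "finite {k. e k = n}"
    by (rule finite_subset) simp
qed (use assms in auto)

lemma proper_pair:
  assumes "proper e" "proper e'"
  shows "proper (\<lambda>(a, b). e a + e' b)"
  unfolding proper_def
proof (intro conjI allI)
  fix n
  have "{k. (case k of (a, b) \<Rightarrow> e a + e' b) = n} \<subseteq>
      (\<Union>i\<in>{0..n}. {a. e a = i} \<times> {b. e' b = n - i})"
  proof
    fix k assume k: "k \<in> {k. (case k of (a, b) \<Rightarrow> e a + e' b) = n}"
    obtain a b where ab: "k = (a, b)" by force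
    have "0 \<le> e a" "0 \<le> e' b" using assms by (auto simp: proper_def)
    then have "e a \<in> {0..n}" "k \<in> {x. e x = e a} \<times> {y. e' y = n - e a}"
      using k by (auto simp: ab)
    then show "k \<in> (\<Union>i\<in>{0..n}. {a. e a = i} \<times> {b. e' b = n - i})" by blast
  qed
  moreover have "finite (\<Union>i\<in>{0..n}. {a. e a = i} \<times> {b. e' b = n - i})"
    using assms by (auto simp: proper_def)
  ultimately show "finite {k. (case k of (a, b) \<Rightarrow> e a + e' b) = n}"
    by (rule finite_subset)
qed (use assms in \<open>auto simp: proper_def\<close>)

lemma proper_inj:
  assumes "proper e" "inj h"
  shows "proper (\<lambda>x. e (h x))"
proof -
  have "{x. e (h x) = n} = h -` {k. e k = n}" for n
    by auto
  then show ?thesis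
    using assms unfolding proper_def by (metis finite_vimageI)
qed

lemma exp_series_mult:
  assumes "proper e" "proper e'"
  shows "exp_series w e * exp_series w' e' = exp_series (\<lambda>(a, b). w a * w' b) (\<lambda>(a, b). e a + e' b)"
proof (rule fps_ext)
  fix n
  let ?S = "\<lambda>i. {a. e a = int i} \<times> {b. e' b = int (n - i)}"
  have eq: "{k. (case k of (a, b) \<Rightarrow> e a + e' b) = int n} = (\<Union>i\<in>{0..n}. ?S i)"
  proof (intro equalityI subsetI)
    fix k assume k: "k \<in> {k. (case k of (a, b) \<Rightarrow> e a + e' b) = int n}"
    obtain a b where ab: "k = (a, b)" by force
    have nn: "0 \<le> e a" "0 \<le> e' b" using assms by (auto simp: proper_def)
    then have "nat (e a) \<in> {0..n}" "k \<in> ?S (nat (e a))"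
      using k by (auto simp: ab)
    then show "k \<in> (\<Union>i\<in>{0..n}. ?S i)" by blast
  qed auto
  have "(exp_series w e * exp_series w' e') $ n =
      (\<Sum>i=0..n. \<Sum>(a, b)\<in>?S i. w a * w' b)"
    by (simp add: fps_mult_nth exp_series_nth sum_product sum.cartesian_product)
  also have "\<dots> = (\<Sum>(a, b)\<in>(\<Union>i\<in>{0..n}. ?S i). w a * w' b)"
    by (rule sum.UNION_disjoint[symmetric]) (use assms in \<open>auto simp: proper_def\<close>)
  finally show "(exp_series w e * exp_series w' e') $ n =
      exp_series (\<lambda>(a, b). w a * w' b) (\<lambda>(a, b). e a + e' b) $ n"
    by (simp only: exp_series_nth eq)
qed

text \<open>Dissection into classes: \<rho> runs through finitely many residues and
  \<open>h \<rho>\<close> parametrises the indices belonging to \<rho>.\<close>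

lemma exp_series_split:
  assumes "proper e" "finite R" "bij_betw (\<lambda>(\<rho>, x). h \<rho> x) (R \<times> UNIV) UNIV"
  shows "exp_series w e = (\<Sum>\<rho>\<in>R. exp_series (\<lambda>x. w (h \<rho> x)) (\<lambda>x. e (h \<rho> x)))"
proof (rule fps_ext)
  fix n
  have inj: "inj_on (\<lambda>(\<rho>, x). h \<rho> x) (R \<times> UNIV)"
    and surj: "(\<lambda>(\<rho>, x). h \<rho> x) ` (R \<times> UNIV) = UNIV"
    using assms(3) by (auto simp: bij_betw_def)
  have inj1: "inj (h \<rho>)" if "\<rho> \<in> R" for \<rho>
    using inj that by (auto simp: inj_on_def)
  have fin: "finite {x. e (h \<rho> x) = int n}" if "\<rho> \<in> R" for \<rho>
    using proper_inj[OF assms(1) inj1[OF that]] by (simp add: proper_def)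
  have "(\<Sum>\<rho>\<in>R. exp_series (\<lambda>x. w (h \<rho> x)) (\<lambda>x. e (h \<rho> x))) $ n =
      (\<Sum>(\<rho>, x)\<in>Sigma R (\<lambda>\<rho>. {x. e (h \<rho> x) = int n}). w (h \<rho> x))"
    using assms(2) fin by (simp add: fps_sum_nth exp_series_nth sum.Sigma)
  also have "\<dots> = (\<Sum>p\<in>(SIGMA \<rho>:R. {x. e (h \<rho> x) = int n}). w (h (fst p) (snd p)))"
    by (simp add: case_prod_unfold)
  also have "\<dots> = (\<Sum>k | e k = int n. w k)"
  proof (rule sum.reindex_bij_betw)
    show "bij_betw (\<lambda>p. h (fst p) (snd p)) (SIGMA \<rho>:R. {x. e (h \<rho> x) = int n}) {k. e k = int n}"
      unfolding bij_betw_def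
    proof
      show "inj_on (\<lambda>p. h (fst p) (snd p)) (SIGMA \<rho>:R. {x. e (h \<rho> x) = int n})"
        using inj by (rule_tac inj_on_subset[of _ "R \<times> UNIV"]) (auto simp: case_prod_unfold)
      show "(\<lambda>p. h (fst p) (snd p)) ` (SIGMA \<rho>:R. {x. e (h \<rho> x) = int n}) = {k. e k = int n}"
      proof (intro equalityI subsetI)
        fix k assume k: "k \<in> {k. e k = int n}"
        have "k \<in> (\<lambda>(\<rho>, x). h \<rho> x) ` (R \<times> UNIV)" using surj by simp
        then show "k \<in> (\<lambda>p. h (fst p) (snd p)) ` (SIGMA \<rho>:R. {x. e (h \<rho> x) = int n})"
          using k by force
      qed auto
    qed
  qed
  finally show "exp_series w e $ n = (\<Sum>\<rho>\<in>R. exp_series (\<lambda>x. w (h \<rho> x)) (\<lambda>x. e (h \<rho> x))) $ n"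
    by (simp add: exp_series_nth)
qed

lemma exp_series_reindex:
  assumes "bij h"
  shows "exp_series w e = exp_series (\<lambda>x. w (h x)) (\<lambda>x. e (h x))"
proof (rule fps_ext)
  fix n
  have "bij_betw h {x. e (h x) = int n} {k. e k = int n}"
    using assms unfolding bij_betw_def
    by (auto simp: inj_on_def surj_def)
  from sum.reindex_bij_betw[OF this, of w]
  show "exp_series w e $ n = exp_series (\<lambda>x. w (h x)) (\<lambda>x. e (h x)) $ n"
    by (simp add: exp_series_nth)
qed

lemma exp_series_add: "exp_series w e + exp_series w' e = exp_series (\<lambda>k. w k + w' k) e"
  by (rule fps_ext) (simp add: exp_series_nth sum.distrib)

lemma exp_series_scale: "fps_const c * exp_series w e = exp_series (\<lambda>k. c * w k) e"
  by (rule fps_ext) (simp add: exp_series_nth sum_distrib_left)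

lemma exp_series_shift:
  assumes "proper e"
  shows "exp_series w (\<lambda>k. e k + int c) = fps_X ^ c * exp_series w e"
proof (rule fps_ext)
  fix n
  have "e k + int c = int n \<longleftrightarrow> c \<le> n \<and> e k = int (n - c)" for k
    using assms[unfolded proper_def, THEN conjunct1, rule_format, of k] by auto
  then have "{k. e k + int c = int n} = (if n < c then {} else {k. e k = int (n - c)})"
    by auto
  then show "exp_series w (\<lambda>k. e k + int c) $ n = (fps_X ^ c * exp_series w e) $ n"
    by (simp add: exp_series_nth fps_X_power_mult_nth)
qed

text \<open>A sign-reversing symmetry makes the series its own negative. This is how whole residue
  classes drop out of the regrouped double sums.\<close>

lemma exp_series_antisym:
  assumes "bij h" "\<And>k. w (h k) = - w k" "\<And>k. e (h k) = e k"
  shows "exp_series w e = 0"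
proof -
  have "exp_series w e = exp_series (\<lambda>k. w (h k)) (\<lambda>k. e (h k))"
    by (rule exp_series_reindex[OF assms(1)])
  also have "\<dots> = exp_series (\<lambda>k. - 1 * w k) e"
    by (rule exp_series_cong) (simp_all add: assms)
  also have "\<dots> = - exp_series w e"
    by (subst exp_series_scale[symmetric]) (simp flip: fps_const_neg)
  finally show ?thesis
    by (simp add: fps_eq_iff)
qed

section \<open>Truncation and infinite products\<close>

text \<open>Congruence modulo q^M. It takes the place of limits: identities between infinite
  products are finite identities read modulo every q^M.\<close>

definition agree_below :: "nat \<Rightarrow> rat fps \<Rightarrow> rat fps \<Rightarrow> bool" where
  "agree_below M a b \<longleftrightarrow> (\<forall>i<M. a $ i = b $ i)"

lemma agree_below_refl [simp]: "agree_below M a a"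
  by (simp add: agree_below_def)

lemma agree_below_sym: "agree_below M a b \<Longrightarrow> agree_below M b a"
  by (simp add: agree_below_def)

lemma agree_below_trans [trans]: "agree_below M a b \<Longrightarrow> agree_below M b c \<Longrightarrow> agree_below M a c"
  by (simp add: agree_below_def)

lemma agree_below_unique: "a = b \<Longrightarrow> agree_below M a a' \<Longrightarrow> agree_below M b b' \<Longrightarrow> agree_below M a' b'"
  by (simp add: agree_below_def)

lemma agree_below_mono: "agree_below M a b \<Longrightarrow> N \<le> M \<Longrightarrow> agree_below N a b"
  by (simp add: agree_below_def)

lemma agree_below_mult: "agree_below M a b \<Longrightarrow> agree_below M a' b' \<Longrightarrow> agree_below M (a * a') (b * b')"
  by (auto simp: agree_below_def fps_mult_nth intro!: sum.cong)

lemma agree_below_power: "agree_below M a b \<Longrightarrow> agree_below M (a ^ n) (b ^ n)"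
  by (induction n) (auto intro: agree_below_mult)

lemma agree_below_eqI: "(\<And>M. agree_below M a b) \<Longrightarrow> a = b"
  by (rule fps_ext) (use lessI in \<open>auto simp: agree_below_def\<close>)

lemma agree_below_prod_1:
  assumes "\<And>i. i \<in> F \<Longrightarrow> agree_below M (g i) 1"
  shows "agree_below M (prod g F) 1"
  using assms
proof (induction F rule: infinite_finite_induct)
  case (insert x F)
  then have "agree_below M (g x * prod g F) (1 * 1)"
    by (intro agree_below_mult) auto
  with insert show ?case by simp
qed auto

text \<open>The infinite product of 1 + \<epsilon> q^(r i) over positive i in I, truncated
  coefficientwise as in \<open>euler_f\<close>. The sign and the index set make room for odd parts
  and residue classes.\<close>

definition euler_prod :: "rat \<Rightarrow> nat \<Rightarrow> nat set \<Rightarrow> rat fps" where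
  "euler_prod \<epsilon> r I = Abs_fps (\<lambda>n. (\<Prod>i\<in>I \<inter> {1..n}. 1 + fps_const \<epsilon> * fps_X ^ (r * i)) $ n)"

lemma euler_prod_agree:
  assumes "0 < r" "finite F" "F \<subseteq> I" "0 \<notin> F" "I \<inter> {1..M} \<subseteq> F"
  shows "agree_below (Suc M) (\<Prod>i\<in>F. 1 + fps_const \<epsilon> * fps_X ^ (r * i)) (euler_prod \<epsilon> r I)"
  unfolding agree_below_def
proof (intro allI impI)
  fix m assume "m < Suc M"
  let ?g = "\<lambda>i. 1 + fps_const \<epsilon> * fps_X ^ (r * i) :: rat fps"
  let ?A = "I \<inter> {1..m}"
  have sub: "?A \<subseteq> F" using assms(5) \<open>m < Suc M\<close> by auto
  have "agree_below (Suc m) (prod ?g (F - ?A)) 1"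
  proof (rule agree_below_prod_1)
    fix i assume "i \<in> F - ?A"
    then have "m < i" using assms by (cases "i = 0") (auto simp: not_le)
    then have "m < r * i" using assms(1)
      by (metis Suc_leI mult_le_mono1 mult_1 order_less_le_trans One_nat_def)
    then show "agree_below (Suc m) (?g i) 1"
      by (auto simp: agree_below_def fps_X_power_nth)
  qed
  then have "agree_below (Suc m) (prod ?g (F - ?A) * prod ?g ?A) (1 * prod ?g ?A)"
    by (rule agree_below_mult) simp
  then have "prod ?g F $ m = prod ?g ?A $ m"
    using prod.subset_diff[OF sub assms(2), of ?g] by (simp add: agree_below_def)
  then show "prod ?g F $ m = euler_prod \<epsilon> r I $ m"
    by (simp add: euler_prod_def)
qed

lemma euler_prod_agree_self:
  assumes "0 < r"
  shows "agree_below (Suc M) (\<Prod>i\<in>I \<inter> {1..M}. 1 + fps_const \<epsilon> * fps_X ^ (r * i)) (euler_prod \<epsilon> r I)"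
  by (rule euler_prod_agree) (use assms in auto)

lemma euler_prod_Un:
  assumes "0 < r" "I \<inter> J = {}"
  shows "euler_prod \<epsilon> r (I \<union> J) = euler_prod \<epsilon> r I * euler_prod \<epsilon> r J"
proof (rule agree_below_eqI)
  fix M
  let ?g = "\<lambda>i. 1 + fps_const \<epsilon> * fps_X ^ (r * i) :: rat fps"
  have "prod ?g ((I \<union> J) \<inter> {1..M}) = prod ?g (I \<inter> {1..M}) * prod ?g (J \<inter> {1..M})"
    using assms(2) by (subst prod.union_disjoint[symmetric]) (auto intro!: prod.cong)
  then have "agree_below (Suc M) (euler_prod \<epsilon> r (I \<union> J)) (euler_prod \<epsilon> r I * euler_prod \<epsilon> r J)"
    by (rule agree_below_unique) (intro agree_below_mult euler_prod_agree_self assms(1))+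
  then show "agree_below M (euler_prod \<epsilon> r (I \<union> J)) (euler_prod \<epsilon> r I * euler_prod \<epsilon> r J)"
    by (rule agree_below_mono) simp
qed

lemma euler_prod_plus_minus:
  assumes "0 < r"
  shows "euler_prod 1 r I * euler_prod (-1) r I = euler_prod (-1) (2 * r) I"
proof (rule agree_below_eqI)
  fix M
  let ?g = "\<lambda>\<epsilon> r i. 1 + fps_const \<epsilon> * fps_X ^ (r * i) :: rat fps"
  have "?g 1 r i * ?g (-1) r i = ?g (-1) (2 * r) i" for i
  proof -
    have "(fps_X :: rat fps) ^ (2 * r * i) = fps_X ^ (r * i) * fps_X ^ (r * i)"
      by (simp add: mult_2 add_mult_distrib flip: power_add)
    then show ?thesis by (simp add: algebra_simps flip: fps_const_neg)
  qed
  then have "prod (?g 1 r) (I \<inter> {1..M}) * prod (?g (-1) r) (I \<inter> {1..M}) =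
      prod (?g (-1) (2 * r)) (I \<inter> {1..M})"
    by (simp flip: prod.distrib)
  then have "agree_below (Suc M) (euler_prod 1 r I * euler_prod (-1) r I) (euler_prod (-1) (2 * r) I)"
    by (rule agree_below_unique) (use assms in \<open>intro agree_below_mult euler_prod_agree_self; simp\<close>)+
  then show "agree_below M (euler_prod 1 r I * euler_prod (-1) r I) (euler_prod (-1) (2 * r) I)"
    by (rule agree_below_mono) simp
qed

lemma euler_prod_image:
  assumes "0 < r" "0 < m"
  shows "euler_prod \<epsilon> r ((*) m ` I) = euler_prod \<epsilon> (r * m) I"
proof (rule agree_below_eqI)
  fix M
  let ?F = "(*) m ` (I \<inter> {1..M})"
  let ?g = "\<lambda>r i. 1 + fps_const \<epsilon> * fps_X ^ (r * i) :: rat fps"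
  have "agree_below (Suc M) (prod (?g r) ?F) (euler_prod \<epsilon> r ((*) m ` I))"
  proof (rule euler_prod_agree)
    show "(*) m ` I \<inter> {1..M} \<subseteq> ?F"
    proof
      fix x assume "x \<in> (*) m ` I \<inter> {1..M}"
      then obtain i where i: "x = m * i" "i \<in> I" "1 \<le> m * i" "m * i \<le> M" by auto
      moreover have "i \<le> m * i" using assms(2) by simp
      ultimately have "i \<le> M" using i(4) by (rule_tac order_trans)
      with i(3) have "i \<in> {1..M}" by (cases "i = 0") auto
      with i show "x \<in> ?F" by blast
    qed
  qed (use assms in auto)
  moreover have "prod (?g r) ?F = prod (?g (r * m)) (I \<inter> {1..M})"
    using assms(2) by (subst prod.reindex) (auto simp: inj_on_def mult.assoc)
  moreover have "agree_below (Suc M) (prod (?g (r * m)) (I \<inter> {1..M})) (euler_prod \<epsilon> (r * m) I)"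
    using assms by (intro euler_prod_agree_self) simp
  ultimately have "agree_below (Suc M) (euler_prod \<epsilon> r ((*) m ` I)) (euler_prod \<epsilon> (r * m) I)"
    by (metis agree_below_sym agree_below_trans)
  then show "agree_below M (euler_prod \<epsilon> r ((*) m ` I)) (euler_prod \<epsilon> (r * m) I)"
    by (rule agree_below_mono) simp
qed

lemma euler_prod_nth_0: "euler_prod \<epsilon> r I $ 0 = 1"
  by (simp add: euler_prod_def)

lemma euler_f_eq_euler_prod: "euler_f r = euler_prod (-1) r UNIV"
  by (rule fps_ext) (simp add: euler_f_def euler_prod_def flip: fps_const_neg)

lemma euler_f_agree:
  assumes "0 < r"
  shows "agree_below (Suc M) (\<Prod>i\<in>{1..M}. 1 - fps_X ^ (r * i)) (euler_f r)"
  using euler_prod_agree_self[OF assms, where I = UNIV and M = M and \<epsilon> = "-1"] by (simp add: euler_f_eq_euler_prod flip: fps_const_neg)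

lemma euler_f_nth_0: "euler_f r $ 0 = 1"
  by (simp add: euler_f_eq_euler_prod euler_prod_nth_0)

lemma euler_f_nonzero: "euler_f r \<noteq> 0"
  using euler_f_nth_0[of r] by auto

section \<open>Gaussian binomial coefficients\<close>

text \<open>The q-Pascal recurrence avoids division, so the coefficients exist for q a power series
  and also for q a constant polynomial over power series.\<close>

fun gauss_binomial :: "'a :: comm_ring_1 \<Rightarrow> nat \<Rightarrow> nat \<Rightarrow> 'a" where
  "gauss_binomial q n 0 = 1"
| "gauss_binomial q 0 (Suc k) = 0"
| "gauss_binomial q (Suc n) (Suc k) = gauss_binomial q n k + q ^ Suc k * gauss_binomial q n (Suc k)"

lemma gauss_binomial_eq_0: "n < k \<Longrightarrow> gauss_binomial q n k = 0"
  by (induction q n k rule: gauss_binomial.induct) auto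

lemma gauss_binomial_self [simp]: "gauss_binomial q n n = 1"
  by (induction n) (auto simp: gauss_binomial_eq_0)

lemma gauss_binomial_factorial:
  "k \<le> n \<Longrightarrow> gauss_binomial q n k * (\<Prod>i\<in>{1..k}. 1 - q ^ i) * (\<Prod>i\<in>{1..n - k}. 1 - q ^ i) =
     (\<Prod>i\<in>{1..n}. 1 - q ^ i)"
proof (induction q n k rule: gauss_binomial.induct)
  case (3 q n k)
  let ?P = "\<lambda>m. \<Prod>i\<in>{1..m}. 1 - q ^ i"
  show ?case
  proof (cases "k = n")
    case True
    then show ?thesis by (simp add: gauss_binomial_eq_0 del: prod.cl_ivl_Suc)
  next
    case False
    with 3 have "Suc k \<le> n" by simp
    have S: "?P (Suc m) = ?P m * (1 - q ^ Suc m)" for m by simp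
    have nk: "n - k = Suc (n - Suc k)" using \<open>Suc k \<le> n\<close> by simp
    have IH1: "gauss_binomial q n k * ?P k * ?P (n - k) = ?P n" using 3 \<open>Suc k \<le> n\<close> by simp
    have IH2: "gauss_binomial q n (Suc k) * ?P (Suc k) * ?P (n - Suc k) = ?P n" using 3 \<open>Suc k \<le> n\<close> by simp
    have pw: "q ^ Suc k * q ^ (n - k) = q ^ Suc n"
      unfolding power_add[symmetric] using \<open>Suc k \<le> n\<close> by simp
    \<comment> \<open>Each Pascal summand becomes an induction hypothesis once one factor is split
      off: 1 - q^(k+1) from the first product, 1 - q^(n-k) from the second.\<close>
    have "gauss_binomial q (Suc n) (Suc k) * ?P (Suc k) * ?P (Suc n - Suc k) =
        (gauss_binomial q n k * ?P k * ?P (n - k)) * (1 - q ^ Suc k) +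
        q ^ Suc k * (gauss_binomial q n (Suc k) * ?P (Suc k) * ?P (n - Suc k)) * (1 - q ^ (n - k))"
      by (simp only: gauss_binomial.simps diff_Suc_Suc S nk) (simp only: algebra_simps)
    also have "\<dots> = ?P n * (1 - q ^ Suc k * q ^ (n - k))"
      unfolding IH1 IH2 by (simp only: algebra_simps mult_1_left)
    also have "\<dots> = ?P (Suc n)" by (simp only: pw S)
    finally show ?thesis .
  qed
qed auto

text \<open>The binomial coefficient of k over 2, extended to negative k; \<open>k * (k - 1)\<close>
  is always even, so the division is exact.\<close>

definition tri :: "int \<Rightarrow> int" where
  "tri k = k * (k - 1) div 2"

lemma tri_double: "2 * tri k = k * (k - 1)"
  by (simp add: tri_def)

lemma tri_nonneg: "0 \<le> tri k"
proof -
  have "0 \<le> k * (k - 1)" by (cases "k \<le> 0") (auto simp: mult_nonpos_nonpos)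
  then show ?thesis using tri_double[of k] by linarith
qed

lemma tri_int_Suc: "tri (int (Suc k)) = tri (int k) + int k"
  using tri_double[of "int (Suc k)"] tri_double[of "int k"] by (simp add: algebra_simps)

text \<open>The homogeneous form with u allows the product to be centred later without negative
  powers of q. In the induction the factor j = 0 is split off, and the remaining factors are those
  for v q in place of v.\<close>

lemma q_binomial:
  fixes u v q :: "'a :: comm_ring_1"
  shows "(\<Prod>j<n. u + v * q ^ j) = (\<Sum>k\<le>n. gauss_binomial q n k * q ^ nat (tri (int k)) * v ^ k * u ^ (n - k))"
proof (induction n arbitrary: v)
  case (Suc n)
  let ?t = "\<lambda>k. nat (tri (int k))"
  have t: "?t (Suc k) = ?t k + k" for k
    using tri_int_Suc[of k] tri_nonneg[of "int k"] by simp
  have t': "nat (tri (1 + int k)) = ?t k + k" for k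
    using t[of k] by simp
  let ?a = "\<lambda>k. gauss_binomial q n k * q ^ (?t k + k) * v ^ k * u ^ (n - k)"
  have "(\<Prod>j<Suc n. u + v * q ^ j) = (u + v) * (\<Prod>j<n. u + (v * q) * q ^ j)"
    by (simp add: prod.lessThan_Suc_shift mult.assoc del: prod.lessThan_Suc)
  also have "\<dots> = (u + v) * (\<Sum>k\<le>n. ?a k)"
    unfolding Suc by (simp add: power_mult_distrib power_add mult_ac)
  also have "\<dots> = u * (\<Sum>k\<le>n. ?a k) + v * (\<Sum>k\<le>n. ?a k)"
    by (simp add: algebra_simps)
  also have "u * (\<Sum>k\<le>n. ?a k) = (\<Sum>k\<le>Suc n. gauss_binomial q n k * q ^ (?t k + k) * v ^ k * u ^ (Suc n - k))"
    by (auto simp: sum_distrib_left gauss_binomial_eq_0 Suc_diff_le mult_ac intro!: sum.cong)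
  also have "\<dots> = u ^ Suc n + (\<Sum>k\<le>n. gauss_binomial q n (Suc k) * q ^ (?t (Suc k) + Suc k) * v ^ Suc k * u ^ (n - k))"
    by (subst sum.atMost_Suc_shift) (simp add: tri_def)
  also have "\<dots> + v * (\<Sum>k\<le>n. ?a k) = u ^ Suc n +
      (\<Sum>k\<le>n. gauss_binomial q (Suc n) (Suc k) * q ^ ?t (Suc k) * v ^ Suc k * u ^ (n - k))"
    by (simp add: sum_distrib_left sum.distrib[symmetric] t' power_add algebra_simps)
  also have "\<dots> = (\<Sum>k\<le>Suc n. gauss_binomial q (Suc n) k * q ^ ?t k * v ^ k * u ^ (Suc n - k))"
    by (subst sum.atMost_Suc_shift) (simp add: tri_def)
  finally show ?case .
qed (simp add: tri_def)

text \<open>In the factorial formula all three finite products have at least M factors, so each is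
  f_r modulo q^M, and the coefficient is 1/f_r there.\<close>

lemma gauss_binomial_agree:
  assumes "0 < r" "M \<le> k" "k + M \<le> n"
  shows "agree_below M (gauss_binomial (fps_X ^ r) n k * euler_f r) 1"
proof -
  let ?P = "\<lambda>m. \<Prod>i\<in>{1..m}. 1 - fps_X ^ (r * i) :: rat fps"
  let ?f = "euler_f r"
  have f: "agree_below M (?P m) ?f" if "M \<le> m" for m
    using euler_f_agree[OF assms(1), of m] that by (auto intro: agree_below_mono)
  have inv: "?f * inverse ?f = 1"
    by (simp add: euler_f_nth_0 inverse_mult_eq_1')
  have "gauss_binomial (fps_X ^ r) n k * ?P k * ?P (n - k) = ?P n"
    using gauss_binomial_factorial[of k n "fps_X ^ r :: rat fps"] assms by (simp flip: power_mult)
  moreover have "agree_below M (gauss_binomial (fps_X ^ r) n k * ?P k * ?P (n - k)) (gauss_binomial (fps_X ^ r) n k * ?f * ?f)"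
    using assms by (intro agree_below_mult f) auto
  moreover have "agree_below M (?P n) ?f"
    using assms by (intro f) auto
  ultimately have "agree_below M (gauss_binomial (fps_X ^ r) n k * ?f * ?f) ?f"
    by (metis agree_below_sym agree_below_trans)
  then have "agree_below M (gauss_binomial (fps_X ^ r) n k * ?f * ?f * inverse ?f) (?f * inverse ?f)"
    by (rule agree_below_mult) simp
  then show ?thesis
    by (simp add: mult.assoc inv)
qed

text \<open>A formal Tannery theorem: an index with exponent below M satisfies |k| \<le> M, where
  the perturbing factor \<open>c k\<close> is 1 modulo q^M.\<close>

lemma exp_series_limit:
  fixes e :: "int \<Rightarrow> int"
  assumes e: "\<And>k. \<bar>k\<bar> - 1 \<le> e k" "\<And>k. 0 \<le> e k"
    and F: "finite F" "{- int M..int M} \<subseteq> F"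
    and c: "\<And>k. \<bar>k\<bar> \<le> int M \<Longrightarrow> agree_below M (c k) 1"
  shows "agree_below M (\<Sum>k\<in>F. fps_const (w k) * c k * fps_X ^ nat (e k)) (exp_series w e)"
  unfolding agree_below_def
proof (intro allI impI)
  fix i assume "i < M"
  have "(\<Sum>k\<in>F. fps_const (w k) * c k * fps_X ^ nat (e k)) $ i =
      (\<Sum>k\<in>F. if e k = int i then w k else 0)"
    unfolding fps_sum_nth
  proof (rule sum.cong)
    fix k assume "k \<in> F"
    have "c k $ (i - nat (e k)) = (if i = nat (e k) then 1 else 0)" if "nat (e k) \<le> i"
    proof -
      have "\<bar>k\<bar> \<le> int M" using that e[of k] \<open>i < M\<close> by linarith
      from c[OF this] that \<open>i < M\<close> show ?thesis by (auto simp: agree_below_def)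
    qed
    moreover have "e k = int i \<longleftrightarrow> nat (e k) = i" using e(2)[of k] by auto
    ultimately show "(fps_const (w k) * c k * fps_X ^ nat (e k)) $ i = (if e k = int i then w k else 0)"
      by (auto simp: fps_X_power_mult_right_nth)
  qed simp
  also have "\<dots> = (\<Sum>k\<in>{k\<in>F. e k = int i}. w k)"
    using F(1) by (simp add: sum.inter_filter)
  also have "{k\<in>F. e k = int i} = {k. e k = int i}"
  proof -
    have "k \<in> F" if "e k = int i" for k
      using e(1)[of k] that \<open>i < M\<close> by (intro subsetD[OF F(2)]) auto
    then show ?thesis by auto
  qed
  finally show "(\<Sum>k\<in>F. fps_const (w k) * c k * fps_X ^ nat (e k)) $ i = exp_series w e $ i"
    by (simp add: exp_series_nth)
qed

section \<open>The Jacobi triple product\<close>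

lemma prod_lessThan_add:
  fixes f :: "nat \<Rightarrow> 'a :: comm_monoid_mult"
  shows "(\<Prod>j<n + m. f j) = (\<Prod>j<n. f j) * (\<Prod>j<m. f (n + j))"
  by (induction m) (simp_all add: mult_ac)

lemma tri_add: "tri (a + b) = tri a + tri b + a * b"
proof -
  have "2 * tri (a + b) = 2 * (tri a + tri b + a * b)"
    by (simp add: tri_double distrib_left) (simp add: algebra_simps)
  then show ?thesis by simp
qed

text \<open>The exponent is b (\<open>tri k\<close> + k) + b' \<open>tri k\<close> with both parts
  nonnegative, hence at least 2 \<open>tri k\<close> + k = k^2.\<close>

lemma triple_exponent_ge:
  assumes "0 < b" "0 < b'"
  shows "\<bar>k\<bar> \<le> int (b + b') * tri k + int b * k"
proof -
  have b: "1 \<le> int b" "1 \<le> int b'" using assms by auto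
  have eq: "int (b + b') * tri k + int b * k = int b * (tri k + k) + int b' * tri k"
    by (simp add: algebra_simps)
  have t: "2 * tri k = k * k - k" using tri_double[of k] by (simp add: algebra_simps)
  have nn: "0 \<le> tri k" "0 \<le> tri k + k"
    using tri_nonneg[of k] tri_nonneg[of "k + 1"] tri_add[of k 1] by (auto simp: tri_def)
  have "1 * (tri k + k) + 1 * tri k \<le> int b * (tri k + k) + int b' * tri k"
    by (intro add_mono mult_right_mono b nn)
  moreover have "1 * (tri k + k) + 1 * tri k = k * k" using t by simp
  moreover have "\<bar>k\<bar> * 1 \<le> \<bar>k\<bar> * \<bar>k\<bar>" by (cases "k = 0") (simp, rule mult_left_mono, auto)
  ultimately show ?thesis unfolding eq by simp
qed

lemma sign_power:
  fixes \<epsilon> :: "'a :: comm_monoid_mult"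
  assumes "\<epsilon> * \<epsilon> = 1" "- int n \<le> l"
  shows "\<epsilon> ^ nat (int n + l) = \<epsilon> ^ n * \<epsilon> ^ nat \<bar>l\<bar>"
proof (cases "0 \<le> l")
  case True
  then have "nat (int n + l) = n + nat \<bar>l\<bar>" by simp
  then show ?thesis by (simp add: power_add)
next
  case False
  then have n: "n = nat (int n + l) + nat \<bar>l\<bar>" using assms(2) by simp
  have "\<epsilon> ^ n * \<epsilon> ^ nat \<bar>l\<bar> = \<epsilon> ^ nat (int n + l) * (\<epsilon> ^ nat \<bar>l\<bar> * \<epsilon> ^ nat \<bar>l\<bar>)"
    by (subst n) (simp add: power_add mult_ac)
  also have "\<dots> = \<epsilon> ^ nat (int n + l)"
    by (simp add: assms(1) flip: power_mult_distrib)
  finally show ?thesis by simp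
qed

lemma sum_shift_bilateral:
  fixes g :: "nat \<Rightarrow> 'a :: comm_monoid_add"
  shows "(\<Sum>k\<le>n + m. g k) = (\<Sum>l\<in>{- int n..int m}. g (nat (int n + l)))"
  by (rule sum.reindex_bij_witness[of _ "\<lambda>l. nat (int n + l)" "\<lambda>k. int k - int n"]) auto

text \<open>The finite Jacobi triple product: the q-binomial theorem with 2 n factors, recentred at
  the middle index.\<close>

lemma triple_product_finite:
  fixes \<epsilon> :: rat
  assumes eps: "\<epsilon> * \<epsilon> = 1" and b: "0 < b" "0 < b'"
  shows "(\<Prod>j<n. 1 + fps_const \<epsilon> * fps_X ^ (b + (b + b') * j)) *
         (\<Prod>j<n. 1 + fps_const \<epsilon> * fps_X ^ (b' + (b + b') * j)) =
         (\<Sum>l\<in>{- int n..int n}. fps_const (\<epsilon> ^ nat \<bar>l\<bar>) * gauss_binomial (fps_X ^ (b + b')) (n + n) (nat (int n + l)) *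
            fps_X ^ nat (int (b + b') * tri l + int b * l))"
    (is "?P * ?P' = ?R")
proof -
  let ?s = "b + b'"
  let ?E = "fps_const \<epsilon> :: rat fps"
  let ?X = "fps_X :: rat fps"
  \<comment> \<open>Dividing by u would give the factors 1 + \<epsilon> q^(b + s (j - n)), whose
    exponents run on both sides of 0. Keeping u clears the negative powers.\<close>
  let ?u = "?X ^ (?s * n)" and ?v = "?E * ?X ^ b" and ?q = "?X ^ ?s"
  \<comment> \<open>The total power of q pulled out of the 2 n factors: the sum from the lower half,
    s n from each factor of the upper half. Both sides are finally divided by \<epsilon>^n
    q^C.\<close>
  define C where "C = (\<Sum>j<n. b + ?s * j) + ?s * n * n"
  have EE: "?E * ?E = 1" using eps by simp
  have intC: "int C = int b * int n + int ?s * tri (int n) + int ?s * int n * int n"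
  proof -
    have "int (\<Sum>j<n. b + ?s * j) = int b * int n + int ?s * tri (int n)"
    proof (induction n)
      case (Suc n)
      then show ?case
        unfolding sum.lessThan_Suc tri_int_Suc of_nat_add by (simp add: algebra_simps)
    qed (simp add: tri_def)
    then show ?thesis by (simp add: C_def)
  qed
  have L1: "(\<Prod>j<n. ?u + ?v * ?q ^ j) = ?E ^ n * ?X ^ (\<Sum>j<n. b + ?s * j) * ?P'"
  proof -
    \<comment> \<open>In the lower half the second term has the smaller exponent and is pulled out;
      \<epsilon>^2 = 1 restores the sign, and reversing j gives the product for b'.\<close>
    have "?u + ?v * ?q ^ j = ?E * ?X ^ (b + ?s * j) * (1 + ?E * ?X ^ (b' + ?s * (n - Suc j)))" if "j < n" for j
    proof -
      have "?s * n = b + ?s * j + (b' + ?s * (n - Suc j))"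
      proof -
        have "n = Suc j + (n - Suc j)" using that by simp
        then have "?s * n = ?s * (Suc j + (n - Suc j))" by simp
        then show ?thesis by (simp add: algebra_simps)
      qed
      then have u: "?u = ?X ^ (b + ?s * j) * ?X ^ (b' + ?s * (n - Suc j))"
        by (simp flip: power_add)
      have "?E * ?X ^ (b + ?s * j) * (1 + ?E * ?X ^ (b' + ?s * (n - Suc j))) =
          ?E * ?X ^ (b + ?s * j) + (?E * ?E) * (?X ^ (b + ?s * j) * ?X ^ (b' + ?s * (n - Suc j)))"
        by (simp only: distrib_left mult_1_left mult_1_right mult_ac)
      also have "\<dots> = ?v * ?q ^ j + ?u"
        unfolding EE u[symmetric] by (simp only: mult_1_left mult.assoc power_add[symmetric] power_mult[symmetric])
      finally show ?thesis by (simp add: add.commute)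
    qed
    then have "(\<Prod>j<n. ?u + ?v * ?q ^ j) =
        (\<Prod>j<n. ?E * ?X ^ (b + ?s * j) * (1 + ?E * ?X ^ (b' + ?s * (n - Suc j))))"
      by (intro prod.cong) auto
    also have "\<dots> = ?E ^ n * ?X ^ (\<Sum>j<n. b + ?s * j) * (\<Prod>j<n. 1 + ?E * ?X ^ (b' + ?s * (n - Suc j)))"
      unfolding prod.distrib by (simp add: power_sum)
    also have "(\<Prod>j<n. 1 + ?E * ?X ^ (b' + ?s * (n - Suc j))) = ?P'"
      by (rule prod.nat_diff_reindex)
    finally show ?thesis .
  qed
  have L2: "(\<Prod>j<n. ?u + ?v * ?q ^ (n + j)) = ?X ^ (?s * n * n) * ?P"
  proof -
    have "?u + ?v * ?q ^ (n + j) = ?u * (1 + ?E * ?X ^ (b + ?s * j))" for j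
      by (simp add: algebra_simps power_add power_mult)
    then have "(\<Prod>j<n. ?u + ?v * ?q ^ (n + j)) = ?u ^ n * ?P"
      by (simp add: prod.distrib)
    then show ?thesis by (simp only: power_mult)
  qed
  have "?E ^ n * ?X ^ C * (?P * ?P') = (\<Prod>j<n + n. ?u + ?v * ?q ^ j)"
    unfolding prod_lessThan_add L1 L2 C_def power_add[of _ "\<Sum>j<n. b + ?s * j"] by (simp only: mult_ac)
  also have "\<dots> = (\<Sum>l\<in>{- int n..int n}. gauss_binomial ?q (n + n) (nat (int n + l)) *
      ?q ^ nat (tri (int (nat (int n + l)))) * ?v ^ nat (int n + l) * ?u ^ (n + n - nat (int n + l)))"
    unfolding q_binomial sum_shift_bilateral ..
  also have "\<dots> = (\<Sum>l\<in>{- int n..int n}. ?E ^ n * ?X ^ C * (fps_const (\<epsilon> ^ nat \<bar>l\<bar>) *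
      gauss_binomial ?q (n + n) (nat (int n + l)) * ?X ^ nat (int ?s * tri l + int b * l)))"
  proof (rule sum.cong)
    fix l assume l: "l \<in> {- int n..int n}"
    define k where "k = nat (int n + l)"
    have k: "int k = int n + l" using l by (simp add: k_def)
    have kn: "k \<le> n + n" using l k by auto
    have e: "0 \<le> int ?s * tri l + int b * l"
      using triple_exponent_ge[OF b, of l] by linarith
    have "int (?s * nat (tri (int k)) + b * k + ?s * n * (n + n - k)) =
        int ?s * tri (int n + l) + int b * (int n + l) + int ?s * int n * (int n - l)"
      using kn tri_nonneg[of "int k"] by (simp add: of_nat_diff k)
    also have "\<dots> = int C + (int ?s * tri l + int b * l)"
      unfolding intC tri_add by (simp add: algebra_simps)
    also have "\<dots> = int (C + nat (int ?s * tri l + int b * l))"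
      using e by simp
    finally have "?s * nat (tri (int k)) + b * k + ?s * n * (n + n - k) =
        C + nat (int ?s * tri l + int b * l)"
      by (simp only: of_nat_eq_iff)
    then have X: "?q ^ nat (tri (int k)) * (?X ^ b) ^ k * ?u ^ (n + n - k) =
        ?X ^ C * ?X ^ nat (int ?s * tri l + int b * l)"
      by (simp only: flip: power_add power_mult)
    have E: "?E ^ k = ?E ^ n * fps_const (\<epsilon> ^ nat \<bar>l\<bar>)"
      unfolding k_def using sign_power[OF EE, of n l] l by simp
    have "gauss_binomial ?q (n + n) k * ?q ^ nat (tri (int k)) * ?v ^ k * ?u ^ (n + n - k) =
        gauss_binomial ?q (n + n) k * ?E ^ k * (?q ^ nat (tri (int k)) * (?X ^ b) ^ k * ?u ^ (n + n - k))"
      by (simp only: power_mult_distrib mult_ac)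
    then show "gauss_binomial ?q (n + n) (nat (int n + l)) *
      ?q ^ nat (tri (int (nat (int n + l)))) * ?v ^ nat (int n + l) * ?u ^ (n + n - nat (int n + l)) =
      ?E ^ n * ?X ^ C * (fps_const (\<epsilon> ^ nat \<bar>l\<bar>) *
      gauss_binomial ?q (n + n) (nat (int n + l)) * ?X ^ nat (int ?s * tri l + int b * l))"
      unfolding k_def[symmetric] X E by (simp only: mult_ac)
  qed simp
  also have "\<dots> = ?E ^ n * ?X ^ C * ?R"
    by (simp only: sum_distrib_left)
  finally show ?thesis
    using eps by (subst (asm) mult_cancel_left) auto
qed

lemma euler_prod_residue:
  assumes "0 < r" "0 < b" "b < s" "M \<le> n"
  shows "agree_below (Suc M) (\<Prod>j<n. 1 + fps_const \<epsilon> * fps_X ^ (r * b + r * s * j)) (euler_prod \<epsilon> r {i. i mod s = b})"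
proof -
  let ?F = "(\<lambda>j. b + s * j) ` {..<n}"
  have "agree_below (Suc M) (\<Prod>i\<in>?F. 1 + fps_const \<epsilon> * fps_X ^ (r * i)) (euler_prod \<epsilon> r {i. i mod s = b})"
  proof (rule euler_prod_agree)
    show "{i. i mod s = b} \<inter> {1..M} \<subseteq> ?F"
    proof
      fix i assume i: "i \<in> {i. i mod s = b} \<inter> {1..M}"
      then have "i = b + s * (i div s)" by (metis IntD1 mem_Collect_eq mod_mult_div_eq)
      moreover have "i div s < i" using i assms by (intro div_less_dividend) auto
      then have "i div s < n" using i assms(4) by auto
      ultimately show "i \<in> ?F" by blast
    qed
  qed (use assms in auto)
  moreover have "(\<Prod>i\<in>?F. 1 + fps_const \<epsilon> * fps_X ^ (r * i)) =
      (\<Prod>j<n. 1 + fps_const \<epsilon> * fps_X ^ (r * b + r * s * j))"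
    using assms by (subst prod.reindex) (auto simp: inj_on_def algebra_simps)
  ultimately show ?thesis by simp
qed

text \<open>The finite identity is multiplied by f_(r (b + b')), which cancels the limit of the
  Gaussian coefficients. For b = b' both residue classes coincide and the product is a
  square.\<close>

theorem triple_product:
  fixes \<epsilon> :: rat
  assumes eps: "\<epsilon> * \<epsilon> = 1" and r: "0 < r" and b: "0 < b" "0 < b'"
  shows "exp_series (\<lambda>k. \<epsilon> ^ nat \<bar>k\<bar>) (\<lambda>k. int r * (int (b + b') * tri k + int b * k)) =
    euler_prod \<epsilon> r {i. i mod (b + b') = b} * euler_prod \<epsilon> r {i. i mod (b + b') = b'} * euler_f (r * (b + b'))"
    (is "exp_series ?w ?e = ?Q * ?Q' * ?f")
proof (rule agree_below_eqI)
  fix M :: nat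
  \<comment> \<open>For |l| \<le> M this keeps both n + l and n - l at least M, as
    \<open>gauss_binomial_agree\<close> requires.\<close>
  let ?n = "M + M"
  let ?q = "fps_X ^ (r * b + r * b') :: rat fps"
  have rb: "0 < r * b" "0 < r * b'" using r b by auto
  have e: "?e = (\<lambda>k. int (r * b + r * b') * tri k + int (r * b) * k)"
    by (simp add: algebra_simps)
  have rs: "r * b + r * b' = r * (b + b')" by (simp add: algebra_simps)
  let ?c = "\<lambda>l. gauss_binomial ?q (?n + ?n) (nat (int ?n + l)) * ?f"
  have A: "agree_below M (\<Sum>l\<in>{- int ?n..int ?n}. fps_const (?w l) * ?c l * fps_X ^ nat (?e l)) (exp_series ?w ?e)"
  proof (rule exp_series_limit)
    fix k
    have *: "\<bar>k\<bar> \<le> ?e k" using triple_exponent_ge[OF rb, of k] by (simp only: fun_cong[OF e])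
    show "\<bar>k\<bar> - 1 \<le> ?e k" using * by linarith
    show "0 \<le> ?e k" using * by linarith
  next
    fix k assume "\<bar>k\<bar> \<le> int M"
    then show "agree_below M (?c k) 1"
      unfolding rs using r b by (intro gauss_binomial_agree) auto
  qed auto
  have B: "(\<Sum>l\<in>{- int ?n..int ?n}. fps_const (?w l) * ?c l * fps_X ^ nat (?e l)) =
      (\<Prod>j<?n. 1 + fps_const \<epsilon> * fps_X ^ (r * b + (r * b + r * b') * j)) *
      (\<Prod>j<?n. 1 + fps_const \<epsilon> * fps_X ^ (r * b' + (r * b + r * b') * j)) * ?f"
    unfolding triple_product_finite[OF eps rb] fun_cong[OF e] sum_distrib_right by (simp only: mult_ac)
  have C: "agree_below M (\<Prod>j<?n. 1 + fps_const \<epsilon> * fps_X ^ (r * b + (r * b + r * b') * j)) ?Q"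
    unfolding rs by (rule agree_below_mono[OF euler_prod_residue[where M = M]]; use r b in simp)
  have D: "agree_below M (\<Prod>j<?n. 1 + fps_const \<epsilon> * fps_X ^ (r * b' + (r * b + r * b') * j)) ?Q'"
    unfolding rs by (rule agree_below_mono[OF euler_prod_residue[where M = M]]; use r b in simp)
  show "agree_below M (exp_series ?w ?e) (?Q * ?Q' * ?f)"
    by (rule agree_below_unique[OF B A]) (intro agree_below_mult C D agree_below_refl)
qed

section \<open>Product evaluations\<close>

lemma range_mult_nat: "0 < m \<Longrightarrow> range ((*) m) = {i :: nat. i mod m = 0}"
  by (auto simp: mod_eq_0_iff_dvd)

lemma euler_f_split:
  assumes "0 < r" "0 < m"
  shows "euler_prod (-1) r {i. i mod m \<noteq> 0} * euler_f (r * m) = euler_f r"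
proof -
  have "euler_prod (-1) r ({i. i mod m \<noteq> 0} \<union> range ((*) m)) = euler_prod (-1) r {i. i mod m \<noteq> 0} * euler_prod (-1) r (range ((*) m))"
    by (rule euler_prod_Un) (use assms in \<open>auto simp: range_mult_nat\<close>)
  moreover have "{i. i mod m \<noteq> 0} \<union> range ((*) m) = UNIV"
    using assms by (auto simp: range_mult_nat)
  ultimately show ?thesis
    using assms by (simp add: euler_prod_image euler_f_eq_euler_prod)
qed

lemma odd_mod4: "{i::nat. i mod 4 = 1} \<union> {i. i mod 4 = 3} = {i. i mod 2 \<noteq> 0}"
  by (rule set_eqI, unfold Un_iff mem_Collect_eq, presburger)

text \<open>The triple product with b = 1, b' = 2: the residues 1 and 2 modulo 3 together with f_(3
  r) make up f_r.\<close>

lemma pentagonal: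
  assumes "0 < r"
  shows "exp_series (\<lambda>k. (-1) ^ nat \<bar>k\<bar>) (\<lambda>k. int r * (3 * tri k + k)) = euler_f r"
proof -
  have un: "{i::nat. i mod 3 = 1} \<union> {i. i mod 3 = 2} = {i. i mod 3 \<noteq> 0}"
    by (rule set_eqI, unfold Un_iff mem_Collect_eq, presburger)
  have "euler_prod (-1) r {i. i mod 3 = 1} * euler_prod (-1) r {i. i mod 3 = 2} = euler_prod (-1) r {i. i mod 3 \<noteq> 0}"
    unfolding un[symmetric] by (rule euler_prod_Un[symmetric]) (use assms in auto)
  moreover have "euler_prod (-1) r {i. i mod 3 \<noteq> 0} * euler_f (r * 3) = euler_f r"
    using assms by (intro euler_f_split) auto
  moreover have "exp_series (\<lambda>k. (-1) ^ nat \<bar>k\<bar>) (\<lambda>k. int r * (int (1 + 2) * tri k + int 1 * k)) =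
      euler_prod (-1) r {i. i mod (1 + 2) = 1} * euler_prod (-1) r {i. i mod (1 + 2) = 2} * euler_f (r * (1 + 2))"
    by (rule triple_product) (use assms in auto)
  moreover have "(1 + 2 :: nat) = 3" by simp
  ultimately show ?thesis by (simp only:) simp
qed

section \<open>Ramanujan's theta functions phi and psi as Euler quotients\<close>

definition phi :: "rat \<Rightarrow> nat \<Rightarrow> rat fps" where
  "phi \<epsilon> r = exp_series (\<lambda>k. \<epsilon> ^ nat \<bar>k\<bar>) (\<lambda>k. int r * k\<^sup>2)"

lemma odd_set: "{i::nat. i mod 2 \<noteq> 0} = {i. i mod 2 = 1}"
  by auto

lemma phi_product:
  assumes "0 < r" "\<epsilon> * \<epsilon> = 1"
  shows "phi \<epsilon> r = euler_prod \<epsilon> r {i. i mod 2 \<noteq> 0} ^ 2 * euler_f (r * 2)"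
proof -
  have tri: "int 2 * tri k + int 1 * k = k\<^sup>2" for k
    using tri_double[of k] by (simp add: power2_eq_square algebra_simps)
  have "phi \<epsilon> r = euler_prod \<epsilon> r {i. i mod 2 = 1} * euler_prod \<epsilon> r {i. i mod 2 = 1} * euler_f (r * 2)"
    using triple_product[of \<epsilon> r 1 1, unfolded one_add_one tri, folded phi_def] assms by simp
  then show ?thesis
    unfolding odd_set power2_eq_square .
qed

lemma phi_minus:
  assumes "0 < r"
  shows "phi (-1) r * euler_f (r * 2) = euler_f r ^ 2"
proof -
  have f: "euler_f r = euler_prod (-1) r {i. i mod 2 \<noteq> 0} * euler_f (r * 2)"
    using euler_f_split[of r 2] assms by simp
  have "phi (-1) r = euler_prod (-1) r {i. i mod 2 \<noteq> 0} ^ 2 * euler_f (r * 2)"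
    using assms by (intro phi_product) auto
  then show ?thesis by (subst f) (simp add: power2_eq_square)
qed

text \<open>Multiplying by the odd part of f_r turns each 1 + x into 1 - x^2, which leaves the odd
  part of f_(2 r), namely f_(2 r)/f_(4 r).\<close>

lemma odd_plus:
  assumes "0 < r"
  shows "euler_prod 1 r {i. i mod 2 \<noteq> 0} * euler_f r * euler_f (r * 4) = euler_f (r * 2) ^ 2"
proof -
  have "euler_prod 1 r {i. i mod 2 \<noteq> 0} * euler_f r * euler_f (r * 4) =
      (euler_prod 1 r {i. i mod 2 \<noteq> 0} * euler_prod (-1) r {i. i mod 2 \<noteq> 0}) * euler_f (r * 2 * 2) * euler_f (r * 2)"
    using euler_f_split[of r 2, symmetric] assms by (simp add: mult_ac)
  also have "\<dots> = euler_f (r * 2) ^ 2"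
    using euler_f_split[of "r * 2" 2] assms
    by (simp only: euler_prod_plus_minus power2_eq_square) (simp add: mult_ac)
  finally show ?thesis .
qed

lemma phi_plus:
  assumes "0 < r"
  shows "phi 1 r * euler_f r ^ 2 * euler_f (r * 4) ^ 2 = euler_f (r * 2) ^ 5"
proof -
  have "phi 1 r * euler_f r ^ 2 * euler_f (r * 4) ^ 2 =
      (euler_prod 1 r {i. i mod 2 \<noteq> 0} * euler_f r * euler_f (r * 4)) ^ 2 * euler_f (r * 2)"
    by (subst phi_product) (use assms in \<open>simp_all add: power_mult_distrib mult_ac\<close>)
  also have "\<dots> = euler_f (r * 2) ^ Suc (2 * 2)"
    by (simp only: odd_plus[OF assms] power_mult power_Suc2)
  finally show ?thesis by simp
qed

text \<open>Ramanujan's psi(q^r): for integer k the values 4 \<open>tri k\<close> + k = k (2 k - 1)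
  run through the triangular numbers, each once. This bilateral form is the triple product with b =
  1, b' = 3.\<close>

definition psi :: "nat \<Rightarrow> rat fps" where
  "psi r = exp_series (\<lambda>k. 1) (\<lambda>k. int r * (4 * tri k + k))"

lemma psi_product:
  assumes "0 < r"
  shows "psi r * euler_f r = euler_f (r * 2) ^ 2"
proof -
  have "psi r = euler_prod 1 r {i. i mod 4 = 1} * euler_prod 1 r {i. i mod 4 = 3} * euler_f (r * 4)"
    using triple_product[of 1 r 1 3] assms by (simp add: psi_def)
  also have "euler_prod 1 r {i. i mod 4 = 1} * euler_prod 1 r {i. i mod 4 = 3} = euler_prod 1 r {i. i mod 2 \<noteq> 0}"
    unfolding odd_mod4[symmetric] by (rule euler_prod_Un[symmetric]) (use assms in auto)
  finally show ?thesis
    using odd_plus[OF assms] by (simp add: mult_ac)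
qed

section \<open>The cube of the Euler product\<close>

lemma gauss_binomial_const_poly: "gauss_binomial [:q:] n k = [:gauss_binomial q n k:]"
  by (induction q n k rule: gauss_binomial.induct) (simp_all flip: pCons_one add: poly_const_pow)

lemma pderiv_sum_poly: "pderiv (\<Sum>i\<in>A. f i) = (\<Sum>i\<in>A. pderiv (f i))"
  by (induction A rule: infinite_finite_induct) (simp_all add: pderiv_add)

text \<open>The q-binomial theorem as a polynomial identity in v, differentiated at a zero x of the
  factor m: by the product rule only the term differentiating that factor survives.\<close>

lemma q_binomial_pderiv:
  fixes u q x :: "'a :: idom"
  assumes root: "u + x * q ^ m = 0" and m: "m < n"
  shows "q ^ m * (\<Prod>j\<in>{..<n} - {m}. u + x * q ^ j) =
    (\<Sum>k\<le>n. of_nat k * (gauss_binomial q n k * q ^ nat (tri (int k)) * x ^ (k - 1) * u ^ (n - k)))"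
proof -
  let ?c = "\<lambda>k. gauss_binomial q n k * q ^ nat (tri (int k)) * u ^ (n - k)"
  let ?f = "\<lambda>j. [:u, q ^ j:]"
  have "(\<Prod>j<n. ?f j) = (\<Prod>j<n. [:u:] + [:0, 1:] * [:q:] ^ j)"
    unfolding poly_const_pow by simp
  also have "\<dots> = (\<Sum>k\<le>n. monom (?c k) k)"
    unfolding q_binomial unfolding gauss_binomial_const_poly poly_const_pow
    by (intro sum.cong refl) (simp add: monom_altdef mult_ac)
  finally have "pderiv (\<Prod>j<n. ?f j) = (\<Sum>k\<le>n. pderiv (monom (?c k) k))"
    by (simp add: pderiv_sum_poly)
  then have "poly (pderiv (\<Prod>j<n. ?f j)) x = (\<Sum>k\<le>n. of_nat k * (?c k * x ^ (k - 1)))"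
    by (simp add: poly_sum pderiv_monom poly_monom mult.assoc)
  moreover have "(\<Prod>j<n. ?f j) = ?f m * (\<Prod>j\<in>{..<n} - {m}. ?f j)"
    using m by (intro prod.remove) auto
  moreover have "poly (pderiv (?f m * p)) x = q ^ m * poly p x" for p
  proof -
    have "poly (pderiv (?f m * p)) x = q ^ m * poly p x + (u + x * q ^ m) * poly (pderiv p) x"
      unfolding pderiv_mult poly_add poly_mult by (simp add: pderiv_pCons algebra_simps)
    then show ?thesis by (simp add: root)
  qed
  ultimately show ?thesis
    by (simp add: poly_prod mult_ac)
qed

text \<open>The product of q^n + x q^j over j < 2 n + 1 (with q^r for q) has its middle factor j = n
  vanishing at x = -1. The n factors on either side each give a copy of the finite Euler product,
  and the derivative supplies the weight l.\<close>

lemma cube_finite: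
  assumes r: "0 < r"
  shows "(\<Prod>i\<in>{1..n}. 1 - fps_X ^ (r * i) :: rat fps) ^ 2 =
    (\<Sum>l\<in>{- int n..int (Suc n)}. fps_const (- ((-1) ^ nat \<bar>l\<bar> * of_int l)) *
       gauss_binomial (fps_X ^ r) (n + Suc n) (nat (int n + l)) * fps_X ^ nat (int r * tri l))"
    (is "?P ^ 2 = ?R")
proof -
  let ?X = "fps_X :: rat fps"
  let ?q = "?X ^ r"
  let ?N = "n + Suc n"
  let ?u = "?q ^ n"
  define C where "C = (\<Sum>j<n. j) + n * n + n"
  have intC: "int C = tri (int n) + int n * int n + int n"
  proof -
    have "int (\<Sum>j<n. j) = tri (int n)"
    proof (induction n)
      case (Suc n)
      then show ?case
        unfolding sum.lessThan_Suc tri_int_Suc of_nat_add by simp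
    qed (simp add: tri_def)
    then show ?thesis by (simp add: C_def)
  qed
  have P: "?P = (\<Prod>j<n. 1 - ?q ^ Suc j)"
    by (rule prod.reindex_bij_witness[of _ Suc "\<lambda>i. i - 1"]) (auto simp: power_mult)
  let ?t = "\<lambda>l. gauss_binomial ?q ?N (nat (int n + l)) * ?X ^ nat (int r * tri l)"
  have trm: "gauss_binomial ?q ?N (nat (int n + l)) * ?q ^ nat (tri (int (nat (int n + l)))) * ?u ^ (?N - nat (int n + l)) =
      ?q ^ C * ?t l" if l: "l \<in> {- int n..int (Suc n)}" for l
  proof -
    define k where "k = nat (int n + l)"
    have k: "int k = int n + l" using l by (simp add: k_def)
    have kn: "k \<le> ?N" using l k by auto
    have "int (nat (tri (int k)) + n * (?N - k)) = tri (int n + l) + int n * (int n + 1 - l)"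
      using kn tri_nonneg[of "int k"] by (simp add: of_nat_diff k)
    also have "\<dots> = int C + tri l"
      unfolding intC tri_add by (simp add: algebra_simps)
    also have "\<dots> = int (C + nat (tri l))"
      using tri_nonneg[of l] by simp
    finally have "nat (tri (int k)) + n * (?N - k) = C + nat (tri l)"
      by (simp only: of_nat_eq_iff)
    then have "?q ^ (nat (tri (int k)) + n * (?N - k)) = ?q ^ (C + nat (tri l))"
      by (simp only:)
    then have X: "?q ^ nat (tri (int k)) * ?u ^ (?N - k) = ?q ^ C * ?q ^ nat (tri l)"
      by (simp only: power_add power_mult[of ?q])
    have "nat (int r * tri l) = r * nat (tri l)"
      by (simp add: nat_mult_distrib)
    then show ?thesis
      unfolding k_def[symmetric] using X by (simp add: power_mult mult_ac)
  qed
  have sgn: "(-1 :: rat fps) ^ nat (int n + l) = (-1) ^ n * (-1) ^ nat \<bar>l\<bar>" if "l \<in> {- int n..int (Suc n)}" for l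
    by (rule sign_power) (use that in auto)
  let ?D = "(-1) ^ n * ?q ^ C"
  have D0: "?D \<noteq> 0" by simp
  let ?S = "{- int n..int (Suc n)}"
  \<comment> \<open>The undifferentiated identity at the zero: the same sum without the weight is 0.
    This later recentres the weight.\<close>
  have "0 = (\<Prod>j<?N. ?u + (-1) * ?q ^ j)"
    by (rule sym, rule prod_zero) (auto intro!: bexI[of _ n])
  also have "\<dots> = (\<Sum>l\<in>?S. ?D * ((-1) ^ nat \<bar>l\<bar> * ?t l))"
    unfolding q_binomial sum_shift_bilateral
  proof (intro sum.cong refl)
    fix l assume l: "l \<in> ?S"
    show "gauss_binomial ?q ?N (nat (int n + l)) * ?q ^ nat (tri (int (nat (int n + l)))) * (-1) ^ nat (int n + l) *
        ?u ^ (?N - nat (int n + l)) = ?D * ((-1) ^ nat \<bar>l\<bar> * ?t l)"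
      using arg_cong[OF trm[OF l], of "\<lambda>x. (-1) ^ nat (int n + l) * x"]
      unfolding sgn[OF l] by (simp only: mult_ac)
  qed
  also have "\<dots> = ?D * (\<Sum>l\<in>?S. (-1) ^ nat \<bar>l\<bar> * ?t l)"
    by (simp only: sum_distrib_left)
  finally have "?D = 0 \<or> (\<Sum>l\<in>?S. (-1) ^ nat \<bar>l\<bar> * ?t l) = 0"
    by (rule mult_eq_0_iff[THEN iffD1, OF sym])
  then have zero: "(\<Sum>l\<in>?S. (-1) ^ nat \<bar>l\<bar> * ?t l) = 0"
    by (rule disjE) (erule notE[OF D0])
  have P1: "(\<Prod>j<n. ?u + (-1) * ?q ^ j) = (-1) ^ n * ?q ^ (\<Sum>j<n. j) * ?P"
  proof -
    have "?u + (-1) * ?q ^ j = (-1) * ?q ^ j * (1 - ?q ^ Suc (n - Suc j))" if "j < n" for j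
    proof -
      have "?u = ?q ^ j * ?q ^ Suc (n - Suc j)"
        using that unfolding power_add[symmetric] by simp
      then show ?thesis by (simp only:) (simp add: algebra_simps del: power_Suc)
    qed
    then have "(\<Prod>j<n. ?u + (-1) * ?q ^ j) = (\<Prod>j<n. (-1) * ?q ^ j * (1 - ?q ^ Suc (n - Suc j)))"
      by (intro prod.cong) auto
    also have "\<dots> = (-1) ^ n * ?q ^ (\<Sum>j<n. j) * (\<Prod>j<n. 1 - ?q ^ Suc (n - Suc j))"
      unfolding prod.distrib power_sum by simp
    also have "(\<Prod>j<n. 1 - ?q ^ Suc (n - Suc j)) = ?P"
      unfolding P by (rule prod.nat_diff_reindex)
    finally show ?thesis .
  qed
  have P2: "(\<Prod>j<n. ?u + (-1) * ?q ^ (Suc n + j)) = ?q ^ (n * n) * ?P"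
  proof -
    have "?u + (-1) * ?q ^ (Suc n + j) = ?u * (1 - ?q ^ Suc j)" for j
      by (simp add: algebra_simps power_add)
    then have "(\<Prod>j<n. ?u + (-1) * ?q ^ (Suc n + j)) = ?u ^ n * (\<Prod>j<n. 1 - ?q ^ Suc j)"
      by (simp only: prod.distrib prod_constant card_lessThan)
    then show ?thesis
      unfolding P by (simp only: power_mult[of ?q])
  qed
  have split: "(\<Prod>j\<in>{..<?N} - {n}. g j) = (\<Prod>j<n. g j) * (\<Prod>j<n. g (Suc n + j))" for g :: "nat \<Rightarrow> rat fps"
  proof -
    have "{..<?N} - {n} = {..<n} \<union> (\<lambda>j. Suc n + j) ` {..<n}"
    proof (intro equalityI subsetI)
      fix x assume "x \<in> {..<?N} - {n}"
      then have "x \<in> {..<n} \<or> (x = Suc n + (x - Suc n) \<and> x - Suc n < n)" by auto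
      then show "x \<in> {..<n} \<union> (\<lambda>j. Suc n + j) ` {..<n}" by blast
    qed auto
    then have "(\<Prod>j\<in>{..<?N} - {n}. g j) = (\<Prod>j\<in>{..<n} \<union> (\<lambda>j. Suc n + j) ` {..<n}. g j)"
      by (rule arg_cong)
    also have "\<dots> = (\<Prod>j<n. g j) * (\<Prod>j\<in>(\<lambda>j. Suc n + j) ` {..<n}. g j)"
      by (rule prod.union_disjoint) auto
    also have "(\<Prod>j\<in>(\<lambda>j. Suc n + j) ` {..<n}. g j) = (\<Prod>j<n. g (Suc n + j))"
      by (subst prod.reindex) (auto simp: inj_on_def)
    finally show ?thesis .
  qed
  have "?D * ?P ^ 2 = ?q ^ n * (\<Prod>j\<in>{..<?N} - {n}. ?u + (-1) * ?q ^ j)"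
    unfolding split P1 P2 C_def power_add[of _ _ n] power_add[of _ _ "n * n"]
    by (simp only: power2_eq_square mult_ac)
  also have "\<dots> = (\<Sum>k\<le>?N. of_nat k * (gauss_binomial ?q ?N k * ?q ^ nat (tri (int k)) * (-1) ^ (k - 1) * ?u ^ (?N - k)))"
    by (rule q_binomial_pderiv) auto
  also have "\<dots> = (\<Sum>l\<in>?S. - ?D * (of_nat n * ((-1) ^ nat \<bar>l\<bar> * ?t l) + of_int l * ((-1) ^ nat \<bar>l\<bar> * ?t l)))"
    unfolding sum_shift_bilateral
  proof (intro sum.cong refl)
    fix l assume l: "l \<in> ?S"
    define k where "k = nat (int n + l)"
    have "(of_nat k :: rat fps) = of_int (int k)" by simp
    also have "int k = int n + l" using l by (simp add: k_def)
    finally have k: "(of_nat k :: rat fps) = of_nat n + of_int l" by simp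
    \<comment> \<open>At k = 0 the truncated exponent is harmless, since the factor k is 0.\<close>
    have "of_nat k * (-1) ^ (k - 1) = - (of_nat k * (-1 :: rat fps) ^ k)"
      by (cases k) simp_all
    also have "\<dots> = - ((of_nat n + of_int l) * ((-1) ^ n * (-1) ^ nat \<bar>l\<bar>))"
      unfolding k unfolding k_def sgn[OF l] ..
    finally have w: "of_nat k * (-1) ^ (k - 1) = - ((of_nat n + of_int l) * ((-1 :: rat fps) ^ n * (-1) ^ nat \<bar>l\<bar>))" .
    have "of_nat k * (gauss_binomial ?q ?N k * ?q ^ nat (tri (int k)) * (-1) ^ (k - 1) * ?u ^ (?N - k)) =
        (of_nat k * (-1) ^ (k - 1)) * (gauss_binomial ?q ?N k * ?q ^ nat (tri (int k)) * ?u ^ (?N - k))"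
      by (simp only: mult_ac)
    also have "\<dots> = - ((of_nat n + of_int l) * ((-1) ^ n * (-1) ^ nat \<bar>l\<bar>)) * (?q ^ C * ?t l)"
      unfolding w using trm[OF l, folded k_def] unfolding k_def[symmetric] by simp
    also have "\<dots> = - ?D * (of_nat n * ((-1) ^ nat \<bar>l\<bar> * ?t l) + of_int l * ((-1) ^ nat \<bar>l\<bar> * ?t l))"
    proof -
      have "- ((a + b) * (s * t)) * (c * y) = - (s * c) * (a * (t * y) + b * (t * y))"
        for a b s t c y :: "rat fps"
        by (simp add: algebra_simps)
      then show ?thesis .
    qed
    finally show "of_nat (nat (int n + l)) * (gauss_binomial ?q ?N (nat (int n + l)) * ?q ^ nat (tri (int (nat (int n + l)))) *
        (-1) ^ (nat (int n + l) - 1) * ?u ^ (?N - nat (int n + l))) =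
        - ?D * (of_nat n * ((-1) ^ nat \<bar>l\<bar> * ?t l) + of_int l * ((-1) ^ nat \<bar>l\<bar> * ?t l))"
      unfolding k_def .
  qed
  \<comment> \<open>With k = n + l the weight splits, and the constant part n multiplies the sum
    shown to be 0.\<close>
  also have "\<dots> = - ?D * (of_nat n * (\<Sum>l\<in>?S. (-1) ^ nat \<bar>l\<bar> * ?t l) + (\<Sum>l\<in>?S. of_int l * ((-1) ^ nat \<bar>l\<bar> * ?t l)))"
    by (simp only: sum_distrib_left[symmetric] sum.distrib)
  also have "\<dots> = ?D * (\<Sum>l\<in>?S. - (of_int l * ((-1) ^ nat \<bar>l\<bar> * ?t l)))"
    unfolding zero by (simp add: sum_negf)
  finally have "?P ^ 2 = (\<Sum>l\<in>?S. - (of_int l * ((-1) ^ nat \<bar>l\<bar> * ?t l)))"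
    by (rule mult_left_cancel[OF D0, THEN iffD1])
  also have "\<dots> = ?R"
  proof (intro sum.cong refl)
    fix l
    have "fps_const (- ((-1) ^ nat \<bar>l\<bar> * of_int l)) = - (of_int l * (-1 :: rat fps) ^ nat \<bar>l\<bar>)"
      by (simp add: fps_of_int[symmetric] mult.commute flip: fps_const_neg fps_const_mult fps_const_power)
    then show "- (of_int l * ((-1) ^ nat \<bar>l\<bar> * ?t l)) = fps_const (- ((-1) ^ nat \<bar>l\<bar> * of_int l)) *
       gauss_binomial ?q ?N (nat (int n + l)) * ?X ^ nat (int r * tri l)"
      by (simp only: mult.assoc mult_minus_left)
  qed
  finally show ?thesis .
qed

lemma tri_ge: "\<bar>k\<bar> - 1 \<le> tri k"
proof -
  define m where "m = \<bar>k\<bar>"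
  have "2 * tri (m - 1) + 2 * (m - 1) \<le> 2 * tri k"
    unfolding tri_double m_def by (cases "0 \<le> k") (auto simp: algebra_simps)
  moreover have "2 * a + 2 * b \<le> 2 * c \<Longrightarrow> 0 \<le> a \<Longrightarrow> b \<le> c" for a b c :: int
    by linarith
  ultimately show ?thesis
    unfolding m_def[symmetric] using tri_nonneg by blast
qed

lemma tri_scaled_ge:
  assumes "0 < r"
  shows "\<bar>k\<bar> - 1 \<le> int r * tri k"
proof -
  have "1 * tri k \<le> int r * tri k"
    using assms tri_nonneg by (intro mult_right_mono) auto
  with tri_ge[of k] show ?thesis by linarith
qed

text \<open>Jacobi's identity in bilateral form. Pairing l with 1 - l, which have the same
  \<open>tri\<close>, gives the usual coefficients (-1)^m (2 m + 1) at m (m + 1)/2.\<close>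

theorem euler_f_cube:
  assumes r: "0 < r"
  shows "exp_series (\<lambda>l. - ((-1) ^ nat \<bar>l\<bar> * of_int l)) (\<lambda>l. int r * tri l) = euler_f r ^ 3"
    (is "exp_series ?w ?e = _")
proof (rule agree_below_eqI)
  fix M :: nat
  let ?n = "M + M"
  let ?c = "\<lambda>l. gauss_binomial (fps_X ^ r) (?n + Suc ?n) (nat (int ?n + l)) * euler_f r"
  have A: "agree_below M (\<Sum>l\<in>{- int ?n..int (Suc ?n)}. fps_const (?w l) * ?c l * fps_X ^ nat (?e l)) (exp_series ?w ?e)"
  proof (rule exp_series_limit)
    fix k
    show "\<bar>k\<bar> - 1 \<le> ?e k" using r by (rule tri_scaled_ge)
    show "0 \<le> ?e k" using tri_nonneg[of k] by simp
  next
    fix k assume "\<bar>k\<bar> \<le> int M"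
    then show "agree_below M (?c k) 1"
      using r by (intro gauss_binomial_agree) auto
  qed auto
  have B: "(\<Sum>l\<in>{- int ?n..int (Suc ?n)}. fps_const (?w l) * ?c l * fps_X ^ nat (?e l)) =
      (\<Prod>i\<in>{1..?n}. 1 - fps_X ^ (r * i)) ^ 2 * euler_f r"
    unfolding cube_finite[OF r] sum_distrib_right by (simp only: mult_ac)
  have "agree_below M (\<Prod>i\<in>{1..?n}. 1 - fps_X ^ (r * i)) (euler_f r)"
    by (rule agree_below_mono[OF euler_f_agree[OF r]]) simp
  then have C: "agree_below M ((\<Prod>i\<in>{1..?n}. 1 - fps_X ^ (r * i)) ^ 2 * euler_f r) (euler_f r ^ 2 * euler_f r)"
    by (intro agree_below_mult agree_below_power agree_below_refl)
  show "agree_below M (exp_series ?w ?e) (euler_f r ^ 3)"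
    using agree_below_unique[OF B A C] by (simp only: power2_eq_square power3_eq_cube)
qed

section \<open>Two theta series of weight 3/2\<close>

abbreviation sgn_pow :: "int \<Rightarrow> rat" where
  "sgn_pow k \<equiv> (-1) ^ nat \<bar>k\<bar>"

lemma sgn_pow_eq: "sgn_pow k = (if even k then 1 else -1)"
  by (simp add: minus_one_power_iff even_nat_iff)

text \<open>The parametrisation is chosen so that first component plus twice the second is 3 j +
  \<rho>; within a class the quadratic form of the exponent then separates in j and the other
  variable.\<close>

lemma bij_mod3:
  "bij_betw (\<lambda>(\<rho>, j, m). (j + \<rho> - 2 * m, m + j)) ({0, 1, 2} \<times> UNIV) (UNIV :: (int \<times> int) set)"
proof (rule bij_betw_byWitness[where f' = "\<lambda>(n, m). ((n + 2 * m) mod 3, (n + 2 * m) div 3, m - (n + 2 * m) div 3)"])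
  show "\<forall>a\<in>{0, 1, 2} \<times> UNIV. (\<lambda>(n, m). ((n + 2 * m) mod 3, (n + 2 * m) div 3, m - (n + 2 * m) div 3))
      ((\<lambda>(\<rho>, j, m). (j + \<rho> - 2 * m, m + j)) a) = (a :: int \<times> int \<times> int)"
  proof
    fix a :: "int \<times> int \<times> int" assume "a \<in> {0, 1, 2} \<times> UNIV"
    then obtain \<rho> j m where a: "a = (\<rho>, j, m)" "\<rho> \<in> {0, 1, 2}" by auto
    have e: "j + \<rho> - 2 * m + 2 * (m + j) = \<rho> + 3 * j" by simp
    have "(\<rho> + 3 * j) mod 3 = \<rho>" "(\<rho> + 3 * j) div 3 = j" using a(2) by auto
    then show "(\<lambda>(n, m). ((n + 2 * m) mod 3, (n + 2 * m) div 3, m - (n + 2 * m) div 3))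
      ((\<lambda>(\<rho>, j, m). (j + \<rho> - 2 * m, m + j)) a) = a"
      unfolding a(1) prod.case e by simp
  qed
  show "\<forall>b\<in>UNIV. (\<lambda>(\<rho>, j, m). (j + \<rho> - 2 * m, m + j))
      ((\<lambda>(n, m). ((n + 2 * m) mod 3, (n + 2 * m) div 3, m - (n + 2 * m) div 3)) b) = (b :: int \<times> int)"
  proof
    fix b :: "int \<times> int"
    obtain n m where b: "b = (n, m)" by force
    show "(\<lambda>(\<rho>, j, m). (j + \<rho> - 2 * m, m + j))
      ((\<lambda>(n, m). ((n + 2 * m) mod 3, (n + 2 * m) div 3, m - (n + 2 * m) div 3)) b) = b"
      unfolding b prod.case by (simp add: algebra_simps minus_mod_eq_mult_div[symmetric])
  qed
  show "(\<lambda>(\<rho>, j, m). (j + \<rho> - 2 * m, m + j)) ` ({0, 1, 2} \<times> UNIV) \<subseteq> (UNIV :: (int \<times> int) set)"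
    by simp
  show "(\<lambda>(n, m). ((n + 2 * m) mod 3, (n + 2 * m) div 3, m - (n + 2 * m) div 3)) ` UNIV
     \<subseteq> {0, 1, 2} \<times> (UNIV :: (int \<times> int) set)"
  proof (rule image_subsetI)
    fix b :: "int \<times> int"
    obtain n m where b: "b = (n, m)" by force
    have "0 \<le> (n + 2 * m) mod 3" "(n + 2 * m) mod 3 < 3" by auto
    then have "(n + 2 * m) mod 3 = 0 \<or> (n + 2 * m) mod 3 = 1 \<or> (n + 2 * m) mod 3 = 2" by linarith
    then show "(\<lambda>(n, m). ((n + 2 * m) mod 3, (n + 2 * m) div 3, m - (n + 2 * m) div 3)) b \<in> {0, 1, 2} \<times> UNIV"
      unfolding b prod.case by simp
  qed
qed

lemma bij_uminus_int: "bij (\<lambda>k :: int. - k)"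
  by (rule o_bij[of uminus]) auto

lemma bij_add_int: "bij (\<lambda>k :: int. k + c)"
  by (rule o_bij[of "\<lambda>k. k - c"]) auto

lemma proper_square: "0 < r \<Longrightarrow> proper (\<lambda>k. int r * k\<^sup>2)"
proof (rule proper_int)
  fix k :: int assume "0 < r"
  then have "1 * k\<^sup>2 \<le> int r * k\<^sup>2" by (intro mult_right_mono) auto
  moreover have "\<bar>k\<bar> \<le> k\<^sup>2"
    using self_le_power[of "\<bar>k\<bar>" 2] by (cases "k = 0") auto
  ultimately show "\<bar>k\<bar> - 1 \<le> int r * k\<^sup>2" by simp
qed simp

lemma proper_tri: "0 < r \<Longrightarrow> proper (\<lambda>k. int r * tri k)"
  by (rule proper_int) (auto intro: tri_scaled_ge mult_nonneg_nonneg tri_nonneg)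

lemma proper_pentagonal: "0 < r \<Longrightarrow> proper (\<lambda>k. int r * (3 * tri k + k))"
proof (rule proper_int)
  fix k :: int assume r: "0 < r"
  have *: "\<bar>k\<bar> \<le> int r * (3 * tri k + k)"
    using triple_exponent_ge[of r "2 * r" k] r by (simp add: algebra_simps)
  show "\<bar>k\<bar> - 1 \<le> int r * (3 * tri k + k)" using * by linarith
  show "0 \<le> int r * (3 * tri k + k)" using * by linarith
qed

definition theta_A :: "nat \<Rightarrow> rat fps" where
  "theta_A r = exp_series (\<lambda>j. 6 * of_int j + 1) (\<lambda>j. int r * (3 * tri j + 2 * j))"

definition theta_B :: "nat \<Rightarrow> rat fps" where
  "theta_B r = exp_series (\<lambda>j. 3 * of_int j + 1) (\<lambda>j. int r * (3 * j\<^sup>2 + 2 * j))"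

lemma tri_neg: "tri (- k) = tri k + k"
  using tri_double[of "- k"] tri_double[of k] by (simp add: algebra_simps)

lemma square_tri: "k\<^sup>2 = 2 * tri k + k"
  using tri_double[of k] by (simp add: algebra_simps power2_eq_square)

lemma proper_theta_A: "0 < r \<Longrightarrow> proper (\<lambda>j. int r * (3 * tri j + 2 * j))"
proof -
  assume "0 < r"
  from proper_inj[OF proper_pentagonal[OF this], of uminus]
  show ?thesis by (simp add: tri_neg algebra_simps)
qed

lemma proper_theta_B: "0 < r \<Longrightarrow> proper (\<lambda>j. int r * (3 * j\<^sup>2 + 2 * j))"
proof (rule proper_int)
  fix k :: int assume r: "0 < r"
  have "\<bar>k\<bar> \<le> int r * (6 * tri k + 5 * k)"
    using triple_exponent_ge[of "5 * r" "r" k] r by (simp add: algebra_simps)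
  then have *: "\<bar>k\<bar> \<le> int r * (3 * k\<^sup>2 + 2 * k)"
    by (simp add: square_tri add.commute)
  show "\<bar>k\<bar> - 1 \<le> int r * (3 * k\<^sup>2 + 2 * k)" using * by linarith
  show "0 \<le> int r * (3 * k\<^sup>2 + 2 * k)" using * by linarith
qed

text \<open>The weight is odd and the exponent even. A multiple of the index may thus be added to a
  weight for free.\<close>

lemma exp_series_odd_0: "exp_series (\<lambda>k. c * of_int k * sgn_pow k) (\<lambda>k. int r * k\<^sup>2) = 0"
  by (rule exp_series_antisym[OF bij_uminus_int]) auto

text \<open>The quintuple product differentiated at a zero: the summands are grouped by
  the exponent \<open>k = n + 2 m\<close> of the auxiliary variable, modulo 3.\<close>

lemma theta_A_product:
  assumes r: "0 < r"
  shows "euler_f r ^ 3 * phi (-1) r = euler_f (r * 2) * theta_A r"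
proof -
  let ?w = "\<lambda>(n, m). - (sgn_pow n * sgn_pow m * of_int (n + 2 * m)) :: rat"
  let ?e = "\<lambda>(n, m). int r * tri n + int r * m\<^sup>2"
  let ?h = "\<lambda>\<rho> (j, m). (j + \<rho> - 2 * m, m + j) :: int \<times> int"
  have pt: "proper (\<lambda>n. int r * tri n)" and ps: "proper (\<lambda>m. int r * m\<^sup>2)"
    using r by (auto intro: proper_tri proper_square)
  have pe: "proper ?e" by (rule proper_pair[OF pt ps])
  have p5: "proper (\<lambda>m. int (r * 2) * (3 * tri m + m))" and pA: "proper (\<lambda>j. int r * (3 * tri j + 2 * j))"
    by (rule proper_pentagonal proper_theta_A; use r in simp)+
  have zero: "exp_series (\<lambda>m. 2 * of_int m * sgn_pow m) (\<lambda>m. int r * m\<^sup>2) = 0"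
    by (rule exp_series_odd_0)
  \<comment> \<open>The second product is 0. It changes the weight n into n + 2 m, which is a
    function of the class variables j and \<rho> alone.\<close>
  have "euler_f r ^ 3 * phi (-1) r =
      exp_series (\<lambda>n. - (sgn_pow n * of_int n)) (\<lambda>n. int r * tri n) * exp_series sgn_pow (\<lambda>m. int r * m\<^sup>2) +
      exp_series (\<lambda>n. - sgn_pow n) (\<lambda>n. int r * tri n) * exp_series (\<lambda>m. 2 * of_int m * sgn_pow m) (\<lambda>m. int r * m\<^sup>2)"
    using r unfolding zero by (simp add: euler_f_cube phi_def)
  also have "\<dots> = exp_series ?w ?e"
    unfolding exp_series_mult[OF pt ps] exp_series_add by (rule exp_series_cong) (auto simp: algebra_simps)
  also have "\<dots> = (\<Sum>\<rho>\<in>{0, 1, 2}. exp_series (\<lambda>x. ?w (?h \<rho> x)) (\<lambda>x. ?e (?h \<rho> x)))"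
    by (rule exp_series_split[OF pe]) (use bij_mod3 in \<open>auto simp: case_prod_unfold\<close>)
  also have "\<dots> = exp_series (\<lambda>x. ?w (?h 0 x)) (\<lambda>x. ?e (?h 0 x)) + exp_series (\<lambda>x. ?w (?h 1 x)) (\<lambda>x. ?e (?h 1 x))
      + exp_series (\<lambda>x. ?w (?h 2 x)) (\<lambda>x. ?e (?h 2 x))"
    by simp
  \<comment> \<open>In this class the exponent is invariant under m to 1 - m, while the sign
    flips.\<close>
  also have "exp_series (\<lambda>x. ?w (?h 2 x)) (\<lambda>x. ?e (?h 2 x)) = 0"
  proof (rule exp_series_antisym)
    show "bij (\<lambda>(j, m). (j, 1 - m) :: int \<times> int)"
      by (rule o_bij[of "\<lambda>(j, m). (j, 1 - m)"]) auto
  next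
    fix x :: "int \<times> int"
    obtain j m where x: "x = (j, m)" by force
    show "?w (?h 2 ((\<lambda>(j, m). (j, 1 - m)) x)) = - ?w (?h 2 x)"
      by (simp add: x sgn_pow_eq)
    have "tri (j + 2 - 2 * (1 - m)) + (1 - m + j)\<^sup>2 = tri (j + 2 - 2 * m) + (m + j)\<^sup>2"
      using tri_double[of "j + 2 - 2 * (1 - m)"] tri_double[of "j + 2 - 2 * m"]
      by (simp add: algebra_simps power2_eq_square)
    then show "?e (?h 2 ((\<lambda>(j, m). (j, 1 - m)) x)) = ?e (?h 2 x)"
      by (simp add: x flip: distrib_left)
  qed
  \<comment> \<open>Negating both variables gives this class the exponent of class 1; the weights 3
    j and 3 j + 1 then add up to 6 j + 1.\<close>
  also have "exp_series (\<lambda>x. ?w (?h 0 x)) (\<lambda>x. ?e (?h 0 x)) =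
      exp_series (\<lambda>(j, m). 3 * of_int j * sgn_pow m) (\<lambda>(j, m). int r * (3 * tri j + 2 * j) + int (r * 2) * (3 * tri m + m))"
    (is "_ = exp_series ?v ?d")
  proof -
    have b: "bij (\<lambda>(j, m). (- j, - m) :: int \<times> int)"
      by (rule o_bij[of "\<lambda>(j, m). (- j, - m)"]) auto
    show ?thesis
      unfolding exp_series_reindex[OF b, of ?v ?d]
    proof (rule exp_series_cong)
      fix x :: "int \<times> int"
      obtain j m where x: "x = (j, m)" by force
      show "?w (?h 0 x) = ?v ((\<lambda>(j, m). (- j, - m)) x)"
        by (simp add: x sgn_pow_eq)
      have "tri (j - 2 * m) + (m + j)\<^sup>2 = 3 * tri (- j) - 2 * j + 2 * (3 * tri (- m) - m)"
        using tri_double[of "j - 2 * m"] tri_double[of "- j"] tri_double[of "- m"]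
        by (simp add: algebra_simps power2_eq_square)
      from arg_cong[OF this, of "(*) (int r)"]
      show "?e (?h 0 x) = ?d ((\<lambda>(j, m). (- j, - m)) x)"
        by (simp add: x algebra_simps)
    qed
  qed
  also have "exp_series (\<lambda>x. ?w (?h 1 x)) (\<lambda>x. ?e (?h 1 x)) =
      exp_series (\<lambda>(j, m). (3 * of_int j + 1) * sgn_pow m) (\<lambda>(j, m). int r * (3 * tri j + 2 * j) + int (r * 2) * (3 * tri m + m))"
    (is "_ = exp_series ?v ?d")
  proof (rule exp_series_cong)
    fix x :: "int \<times> int"
    obtain j m where x: "x = (j, m)" by force
    show "?w (?h 1 x) = ?v x"
      by (simp add: x sgn_pow_eq)
    have "tri (j + 1 - 2 * m) + (m + j)\<^sup>2 = 3 * tri j + 2 * j + 2 * (3 * tri m + m)"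
      using tri_double[of "j + 1 - 2 * m"] tri_double[of j] tri_double[of m]
      by (simp add: algebra_simps power2_eq_square)
    from arg_cong[OF this, of "(*) (int r)"]
    show "?e (?h 1 x) = ?d x"
      by (simp add: x algebra_simps)
  qed
  finally have "euler_f r ^ 3 * phi (-1) r =
      exp_series (\<lambda>(j, m). (6 * of_int j + 1) * sgn_pow m) (\<lambda>(j, m). int r * (3 * tri j + 2 * j) + int (r * 2) * (3 * tri m + m))"
    unfolding exp_series_add add_0_right by (rule trans) (rule exp_series_cong; auto simp: field_simps)
  also have "\<dots> = theta_A r * exp_series sgn_pow (\<lambda>m. int (r * 2) * (3 * tri m + m))"
    unfolding theta_A_def exp_series_mult[OF pA p5] ..
  also have "exp_series sgn_pow (\<lambda>m. int (r * 2) * (3 * tri m + m)) = euler_f (r * 2)"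
    by (rule pentagonal) (use r in simp)
  finally show ?thesis
    by (simp only: mult.commute)
qed

text \<open>The regrouping of \<open>theta_A_product\<close> with roles exchanged: the auxiliary
  exponent is m + 2 n, with m from phi and n from the cube of f_(4 r). The weight n of the cube is
  half of 2 n, hence the division by 2. Class 1 cancels, classes 0 and 2 contribute 3 j/2 and (3 j +
  2)/2, and one factor f_(4 r) is cancelled at the end.\<close>

lemma theta_B_product:
  assumes r: "0 < r"
  shows "euler_f (r * 4) ^ 2 * phi (-1) r = theta_B r"
proof -
  let ?w = "\<lambda>(m, n). - (sgn_pow m * sgn_pow n * of_int (m + 2 * n) / 2) :: rat"
  let ?e = "\<lambda>(m, n). int r * m\<^sup>2 + int (r * 4) * tri n"
  let ?h = "\<lambda>\<rho> (j, n). (j + \<rho> - 2 * n, n + j) :: int \<times> int"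
  have pt: "proper (\<lambda>n. int (r * 4) * tri n)" and ps: "proper (\<lambda>m. int r * m\<^sup>2)"
    by (rule proper_tri proper_square; use r in simp)+
  have pe: "proper ?e" by (rule proper_pair[OF ps pt])
  have p5: "proper (\<lambda>n. int (r * 4) * (3 * tri n + n))" and pB: "proper (\<lambda>j. int r * (3 * j\<^sup>2 + 2 * j))"
    by (rule proper_pentagonal proper_theta_B; use r in simp)+
  have zero: "exp_series (\<lambda>m. - (1 / 2) * of_int m * sgn_pow m) (\<lambda>m. int r * m\<^sup>2) = 0"
    by (rule exp_series_odd_0)
  have cube: "exp_series (\<lambda>n. - (sgn_pow n * of_int n)) (\<lambda>n. int (r * 4) * tri n) = euler_f (r * 4) ^ 3"
    by (rule euler_f_cube) (use r in simp)
  have "phi (-1) r * euler_f (r * 4) ^ 3 =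
      exp_series sgn_pow (\<lambda>m. int r * m\<^sup>2) * exp_series (\<lambda>n. - (sgn_pow n * of_int n)) (\<lambda>n. int (r * 4) * tri n) +
      exp_series (\<lambda>m. - (1 / 2) * of_int m * sgn_pow m) (\<lambda>m. int r * m\<^sup>2) * exp_series sgn_pow (\<lambda>n. int (r * 4) * tri n)"
    unfolding zero cube by (simp add: phi_def)
  also have "\<dots> = exp_series ?w ?e"
    unfolding exp_series_mult[OF ps pt] exp_series_add by (rule exp_series_cong) (auto simp: field_simps)
  also have "\<dots> = (\<Sum>\<rho>\<in>{0, 1, 2}. exp_series (\<lambda>x. ?w (?h \<rho> x)) (\<lambda>x. ?e (?h \<rho> x)))"
    by (rule exp_series_split[OF pe]) (use bij_mod3 in \<open>auto simp: case_prod_unfold\<close>)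
  also have "\<dots> = exp_series (\<lambda>x. ?w (?h 0 x)) (\<lambda>x. ?e (?h 0 x)) + exp_series (\<lambda>x. ?w (?h 2 x)) (\<lambda>x. ?e (?h 2 x))
      + exp_series (\<lambda>x. ?w (?h 1 x)) (\<lambda>x. ?e (?h 1 x))"
    by simp
  also have "exp_series (\<lambda>x. ?w (?h 1 x)) (\<lambda>x. ?e (?h 1 x)) = 0"
  proof (rule exp_series_antisym)
    show "bij (\<lambda>(j, n). (j, 1 - n) :: int \<times> int)"
      by (rule o_bij[of "\<lambda>(j, n). (j, 1 - n)"]) auto
  next
    fix x :: "int \<times> int"
    obtain j n where x: "x = (j, n)" by force
    show "?w (?h 1 ((\<lambda>(j, n). (j, 1 - n)) x)) = - ?w (?h 1 x)"
      by (simp add: x sgn_pow_eq)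
    have "(j + 1 - 2 * (1 - n))\<^sup>2 + 4 * tri (1 - n + j) = (j + 1 - 2 * n)\<^sup>2 + 4 * tri (n + j)"
      using tri_double[of "1 - n + j"] tri_double[of "n + j"]
      by (simp add: algebra_simps power2_eq_square)
    from arg_cong[OF this, of "(*) (int r)"]
    show "?e (?h 1 ((\<lambda>(j, n). (j, 1 - n)) x)) = ?e (?h 1 x)"
      by (simp add: x algebra_simps)
  qed
  also have "exp_series (\<lambda>x. ?w (?h 0 x)) (\<lambda>x. ?e (?h 0 x)) =
      exp_series (\<lambda>(j, n). (3 * of_int j / 2) * sgn_pow n) (\<lambda>(j, n). int r * (3 * j\<^sup>2 + 2 * j) + int (r * 4) * (3 * tri n + n))"
    (is "_ = exp_series ?v ?d")
  proof -
    have b: "bij (\<lambda>(j, n). (- j, n) :: int \<times> int)"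
      by (rule o_bij[of "\<lambda>(j, n). (- j, n)"]) auto
    show ?thesis
      unfolding exp_series_reindex[OF b, of ?v ?d]
    proof (rule exp_series_cong)
      fix x :: "int \<times> int"
      obtain j n where x: "x = (j, n)" by force
      show "?w (?h 0 x) = ?v ((\<lambda>(j, n). (- j, n)) x)"
        by (simp add: x sgn_pow_eq)
      have "(j - 2 * n)\<^sup>2 + 4 * tri (n + j) = 3 * j\<^sup>2 - 2 * j + 4 * (3 * tri n + n)"
        using tri_double[of "n + j"] tri_double[of n]
        by (simp add: algebra_simps power2_eq_square)
      from arg_cong[OF this, of "(*) (int r)"]
      show "?e (?h 0 x) = ?d ((\<lambda>(j, n). (- j, n)) x)"
        by (simp add: x algebra_simps)
    qed
  qed
  also have "exp_series (\<lambda>x. ?w (?h 2 x)) (\<lambda>x. ?e (?h 2 x)) =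
      exp_series (\<lambda>(j, n). ((3 * of_int j + 2) / 2) * sgn_pow n) (\<lambda>(j, n). int r * (3 * j\<^sup>2 + 2 * j) + int (r * 4) * (3 * tri n + n))"
    (is "_ = exp_series ?v ?d")
  proof -
    have b: "bij (\<lambda>(j, n). (j, 1 - n) :: int \<times> int)"
      by (rule o_bij[of "\<lambda>(j, n). (j, 1 - n)"]) auto
    show ?thesis
      unfolding exp_series_reindex[OF b, of ?v ?d]
    proof (rule exp_series_cong)
      fix x :: "int \<times> int"
      obtain j n where x: "x = (j, n)" by force
      show "?w (?h 2 x) = ?v ((\<lambda>(j, n). (j, 1 - n)) x)"
        by (simp add: x sgn_pow_eq)
      have "(j + 2 - 2 * n)\<^sup>2 + 4 * tri (n + j) = 3 * j\<^sup>2 + 2 * j + 4 * (3 * tri (1 - n) + (1 - n))"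
        using tri_double[of "n + j"] tri_double[of "1 - n"]
        by (simp add: algebra_simps power2_eq_square)
      from arg_cong[OF this, of "(*) (int r)"]
      show "?e (?h 2 x) = ?d ((\<lambda>(j, n). (j, 1 - n)) x)"
        by (simp add: x algebra_simps)
    qed
  qed
  finally have "phi (-1) r * euler_f (r * 4) ^ 3 =
      exp_series (\<lambda>(j, n). (3 * of_int j + 1) * sgn_pow n) (\<lambda>(j, n). int r * (3 * j\<^sup>2 + 2 * j) + int (r * 4) * (3 * tri n + n))"
    unfolding exp_series_add add_0_right by (rule trans) (rule exp_series_cong; auto simp: field_simps)
  also have "\<dots> = theta_B r * exp_series sgn_pow (\<lambda>n. int (r * 4) * (3 * tri n + n))"
    unfolding theta_B_def exp_series_mult[OF pB p5] ..
  also have "exp_series sgn_pow (\<lambda>n. int (r * 4) * (3 * tri n + n)) = euler_f (r * 4)"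
    by (rule pentagonal) (use r in simp)
  finally have 1: "phi (-1) r * euler_f (r * 4) ^ 3 = theta_B r * euler_f (r * 4)" .
  have 2: "phi (-1) r * euler_f (r * 4) ^ 3 = euler_f (r * 4) * (euler_f (r * 4) ^ 2 * phi (-1) r)"
    by (simp only: power2_eq_square power3_eq_cube mult_ac)
  have "euler_f (r * 4) * (euler_f (r * 4) ^ 2 * phi (-1) r) = euler_f (r * 4) * theta_B r"
    by (rule trans[OF sym[OF 2] trans[OF 1 mult.commute]])
  then show ?thesis
    by (rule mult_left_cancel[OF euler_f_nonzero, THEN iffD1])
qed

section \<open>The 2-dissection of phi(-q)^2\<close>

lemma bij_parity:
  "bij_betw (\<lambda>(\<rho>, a, b). (a + b + \<rho>, a - b)) ({0, 1} \<times> UNIV) (UNIV :: (int \<times> int) set)"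
proof (rule bij_betw_byWitness[where f' = "\<lambda>(k, l). ((k + l) mod 2, (k + l) div 2, (k + l) div 2 - l)"])
  show "\<forall>x\<in>{0, 1} \<times> UNIV. (\<lambda>(k, l). ((k + l) mod 2, (k + l) div 2, (k + l) div 2 - l))
      ((\<lambda>(\<rho>, a, b). (a + b + \<rho>, a - b)) x) = (x :: int \<times> int \<times> int)"
  proof
    fix x :: "int \<times> int \<times> int" assume "x \<in> {0, 1} \<times> UNIV"
    then obtain \<rho> a b where x: "x = (\<rho>, a, b)" "\<rho> \<in> {0, 1}" by auto
    have e: "a + b + \<rho> + (a - b) = \<rho> + 2 * a" by simp
    have "(\<rho> + 2 * a) mod 2 = \<rho>" "(\<rho> + 2 * a) div 2 = a" using x(2) by auto
    then show "(\<lambda>(k, l). ((k + l) mod 2, (k + l) div 2, (k + l) div 2 - l))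
      ((\<lambda>(\<rho>, a, b). (a + b + \<rho>, a - b)) x) = x"
      unfolding x(1) prod.case e by simp
  qed
  show "\<forall>y\<in>UNIV. (\<lambda>(\<rho>, a, b). (a + b + \<rho>, a - b))
      ((\<lambda>(k, l). ((k + l) mod 2, (k + l) div 2, (k + l) div 2 - l)) y) = (y :: int \<times> int)"
  proof
    fix y :: "int \<times> int"
    obtain k l where y: "y = (k, l)" by force
    show "(\<lambda>(\<rho>, a, b). (a + b + \<rho>, a - b))
      ((\<lambda>(k, l). ((k + l) mod 2, (k + l) div 2, (k + l) div 2 - l)) y) = y"
      unfolding y prod.case by (simp add: algebra_simps minus_mod_eq_mult_div[symmetric])
  qed
  show "(\<lambda>(\<rho>, a, b). (a + b + \<rho>, a - b)) ` ({0, 1} \<times> UNIV) \<subseteq> (UNIV :: (int \<times> int) set)"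
    by simp
  show "(\<lambda>(k, l). ((k + l) mod 2, (k + l) div 2, (k + l) div 2 - l)) ` UNIV
     \<subseteq> {0, 1} \<times> (UNIV :: (int \<times> int) set)"
    by auto
qed

lemma bij_parity_single: "bij_betw (\<lambda>(\<rho>, k). 2 * k + \<rho>) ({0, 1} \<times> UNIV) (UNIV :: int set)"
proof (rule bij_betw_byWitness[where f' = "\<lambda>k. (k mod 2, k div 2)"])
  show "(\<lambda>k. (k mod 2, k div 2)) ` UNIV \<subseteq> {0, 1} \<times> (UNIV :: int set)" by auto
qed auto

text \<open>k and -1 - k give the same oblong number, so every one occurs twice. Splitting k by
  parity produces the two copies of psi.\<close>

lemma psi_oblong:
  assumes r: "0 < r"
  shows "exp_series (\<lambda>k. 1) (\<lambda>k. int (2 * r) * (k\<^sup>2 + k)) = fps_const 2 * psi (4 * r)"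
    and "proper (\<lambda>k. int (2 * r) * (k\<^sup>2 + k))"
proof -
  let ?e = "\<lambda>k. int (2 * r) * (k\<^sup>2 + k)"
  let ?d = "\<lambda>k. int (4 * r) * (4 * tri k + k)"
  show p: "proper ?e"
  proof -
    have "proper (\<lambda>k. int (4 * r) * tri (- k))"
      by (rule proper_inj[OF proper_tri]) (use r in auto)
    moreover have "?e k = int (4 * r) * tri (- k)" for k
    proof -
      have "k\<^sup>2 + k = 2 * tri (- k)"
        using tri_double[of "- k"] by (simp add: algebra_simps power2_eq_square)
      then show ?thesis by simp
    qed
    ultimately show ?thesis by (simp only:)
  qed
  have "exp_series (\<lambda>k. 1) ?e = (\<Sum>\<rho>\<in>{0, 1}. exp_series (\<lambda>k. 1) (\<lambda>k. ?e (2 * k + \<rho>)))"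
    by (rule exp_series_split[OF p]) (use bij_parity_single in auto)
  also have "\<dots> = exp_series (\<lambda>k. 1) (\<lambda>k. ?e (2 * k + 0)) + exp_series (\<lambda>k. 1) (\<lambda>k. ?e (2 * k + 1))"
    by simp
  also have "exp_series (\<lambda>k. 1) (\<lambda>k. ?e (2 * k + 0)) = psi (4 * r)"
    unfolding psi_def exp_series_reindex[OF bij_uminus_int, of "\<lambda>k. 1" ?d]
  proof (rule exp_series_cong)
    fix k :: int
    have "(2 * k + 0)\<^sup>2 + (2 * k + 0) = 2 * (4 * tri (- k) + - k)"
      using tri_double[of "- k"] by (simp add: algebra_simps power2_eq_square)
    then have "?e (2 * k + 0) = int (2 * r) * (2 * (4 * tri (- k) + - k))"
      by (simp only:)
    also have "\<dots> = ?d (- k)" by simp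
    finally show "?e (2 * k + 0) = ?d (- k)" .
  qed simp
  also have "exp_series (\<lambda>k. 1) (\<lambda>k. ?e (2 * k + 1)) = psi (4 * r)"
    unfolding psi_def exp_series_reindex[OF bij_add_int[of 1], of "\<lambda>k. 1" ?d]
  proof (rule exp_series_cong)
    fix k :: int
    have "(2 * k + 1)\<^sup>2 + (2 * k + 1) = 2 * (4 * tri (k + 1) + (k + 1))"
      using tri_double[of "k + 1"] by (simp add: algebra_simps power2_eq_square)
    then have "?e (2 * k + 1) = int (2 * r) * (2 * (4 * tri (k + 1) + (k + 1)))"
      by (simp only:)
    also have "\<dots> = ?d (k + 1)" by simp
    finally show "?e (2 * k + 1) = ?d (k + 1)" .
  qed simp
  also have "psi (4 * r) + psi (4 * r) = fps_const 2 * psi (4 * r)"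
    by (simp add: numeral_fps_const[symmetric])
  finally show "exp_series (\<lambda>k. 1) ?e = fps_const 2 * psi (4 * r)" .
qed

text \<open>With k + l = 2 a + \<rho> the form k^2 + l^2 is 2 a^2 + 2 b^2 for \<rho> = 0 and 2 (a^2
  + a) + 2 (b^2 + b) + 1 for \<rho> = 1, where the sign is -1; the factor 4 comes from
  \<open>psi_oblong\<close> squared.\<close>

lemma phi_dissection:
  assumes r: "0 < r"
  shows "phi (-1) r ^ 2 = phi 1 (2 * r) ^ 2 - 4 * fps_X ^ r * psi (4 * r) ^ 2"
proof -
  let ?w = "\<lambda>(k, l). sgn_pow k * sgn_pow l"
  let ?e = "\<lambda>(k, l). int r * k\<^sup>2 + int r * l\<^sup>2"
  let ?h = "\<lambda>\<rho> (a, b). (a + b + \<rho>, a - b) :: int \<times> int"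
  let ?o = "\<lambda>k. int (2 * r) * (k\<^sup>2 + k)"
  have ps: "proper (\<lambda>k. int r * k\<^sup>2)" and ps2: "proper (\<lambda>k. int (2 * r) * k\<^sup>2)"
    by (rule proper_square; use r in simp)+
  have po: "proper ?o" by (rule psi_oblong(2)[OF r])
  have pe: "proper ?e" by (rule proper_pair[OF ps ps])
  have "phi (-1) r ^ 2 = exp_series ?w ?e"
    unfolding power2_eq_square[where 'a = "rat fps"] phi_def exp_series_mult[OF ps ps] ..
  also have "\<dots> = (\<Sum>\<rho>\<in>{0, 1}. exp_series (\<lambda>x. ?w (?h \<rho> x)) (\<lambda>x. ?e (?h \<rho> x)))"
    by (rule exp_series_split[OF pe]) (use bij_parity in \<open>auto simp: case_prod_unfold\<close>)
  also have "\<dots> = exp_series (\<lambda>x. ?w (?h 0 x)) (\<lambda>x. ?e (?h 0 x)) + exp_series (\<lambda>x. ?w (?h 1 x)) (\<lambda>x. ?e (?h 1 x))"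
    by simp
  also have "exp_series (\<lambda>x. ?w (?h 0 x)) (\<lambda>x. ?e (?h 0 x)) = phi 1 (2 * r) ^ 2"
    unfolding power2_eq_square[where 'a = "rat fps"] phi_def exp_series_mult[OF ps2 ps2]
    by (rule exp_series_cong) (auto simp: sgn_pow_eq algebra_simps power2_eq_square)
  also have "exp_series (\<lambda>x. ?w (?h 1 x)) (\<lambda>x. ?e (?h 1 x)) =
      fps_const (- 1) * exp_series (\<lambda>(a, b). 1 * 1) (\<lambda>x. (case x of (a, b) \<Rightarrow> ?o a + ?o b) + int r)"
    unfolding exp_series_scale by (rule exp_series_cong) (auto simp: sgn_pow_eq algebra_simps power2_eq_square)
  also have "exp_series (\<lambda>(a, b). 1 * 1) (\<lambda>x. (case x of (a, b) \<Rightarrow> ?o a + ?o b) + int r) =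
      fps_X ^ r * (exp_series (\<lambda>k. 1) ?o * exp_series (\<lambda>k. 1) ?o)"
    unfolding exp_series_shift[OF proper_pair[OF po po]] exp_series_mult[OF po po] ..
  also have "fps_const (- 1) * (fps_X ^ r * (exp_series (\<lambda>k. 1) ?o * exp_series (\<lambda>k. 1) ?o)) =
      - (4 * fps_X ^ r * psi (4 * r) ^ 2)"
    unfolding psi_oblong(1)[OF r]
    by (simp add: numeral_fps_const[symmetric] power2_eq_square flip: fps_const_neg)
  finally show ?thesis by simp
qed

theorem eta_quotient_dissection:
  "euler_f 1 ^ 4 * euler_f 2 ^ 2 = theta_A 4 ^ 2 - 4 * fps_X * theta_B 2 ^ 2"
proof -
  let ?f = euler_f
  \<comment> \<open>Both sides equal f_4^5/f_8^2, a series in q^4; hence the parameter 4.\<close>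
  have A: "theta_A 4 = ?f 2 ^ 2 * phi 1 2"
  proof -
    have "?f 8 ^ 2 * theta_A 4 = ?f 8 * (?f 8 * theta_A 4)"
      by (simp add: power2_eq_square)
    also have "?f 8 * theta_A 4 = ?f 4 ^ 3 * phi (-1) 4"
      using theta_A_product[of 4] by simp
    also have "?f 8 * (?f 4 ^ 3 * phi (-1) 4) = ?f 4 ^ 3 * (phi (-1) 4 * ?f 8)"
      by (simp only: mult_ac)
    also have "phi (-1) 4 * ?f 8 = ?f 4 ^ 2"
      using phi_minus[of 4] by simp
    also have "?f 4 ^ 3 * ?f 4 ^ 2 = ?f 4 ^ 5"
      by (simp flip: power_add)
    also have "\<dots> = phi 1 2 * ?f 2 ^ 2 * ?f 8 ^ 2"
      using phi_plus[of 2] by simp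
    also have "\<dots> = ?f 8 ^ 2 * (?f 2 ^ 2 * phi 1 2)"
      by (simp only: mult_ac)
    finally show ?thesis
      by (rule mult_left_cancel[THEN iffD1, rotated]) (simp add: euler_f_nonzero)
  qed
  \<comment> \<open>Both sides equal f_2^2 f_8^2/f_4, a series in q^2.\<close>
  have B: "theta_B 2 = ?f 2 ^ 2 * psi 4"
  proof -
    have "?f 4 * theta_B 2 = ?f 8 ^ 2 * (phi (-1) 2 * ?f 4)"
      using theta_B_product[of 2] by (simp add: mult_ac)
    also have "phi (-1) 2 * ?f 4 = ?f 2 ^ 2"
      using phi_minus[of 2] by simp
    also have "?f 8 ^ 2 = psi 4 * ?f 4"
      using psi_product[of 4] by simp
    also have "psi 4 * ?f 4 * ?f 2 ^ 2 = ?f 4 * (?f 2 ^ 2 * psi 4)"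
      by (simp only: mult_ac)
    finally show ?thesis
      by (rule mult_left_cancel[THEN iffD1, rotated]) (simp add: euler_f_nonzero)
  qed
  have "?f 1 ^ 4 * ?f 2 ^ 2 = (?f 1 ^ 2) ^ 2 * ?f 2 ^ 2"
    by (simp flip: power_mult)
  also have "?f 1 ^ 2 = phi (-1) 1 * ?f 2"
    using phi_minus[of 1] by simp
  also have "(phi (-1) 1 * ?f 2) ^ 2 * ?f 2 ^ 2 = phi (-1) 1 ^ 2 * (?f 2 ^ 2 * ?f 2 ^ 2)"
    by (simp only: power_mult_distrib mult_ac)
  also have "phi (-1) 1 ^ 2 = phi 1 2 ^ 2 - 4 * fps_X * psi 4 ^ 2"
    using phi_dissection[of 1] by simp
  finally show ?thesis
    unfolding A B by (simp add: power2_eq_square algebra_simps)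
qed

section \<open>Arithmetic modulo 11\<close>

definition integral_fps :: "rat fps \<Rightarrow> bool" where
  "integral_fps f \<longleftrightarrow> (\<forall>n. f $ n \<in> \<int>)"

definition mult11 :: "rat set" where
  "mult11 = range (\<lambda>m :: int. of_int (11 * m))"

lemma mult11_0: "0 \<in> mult11"
  unfolding mult11_def by (rule image_eqI[of _ _ 0]) auto

lemma mult11_add: "a \<in> mult11 \<Longrightarrow> b \<in> mult11 \<Longrightarrow> a + b \<in> mult11"
  unfolding mult11_def by (auto simp flip: of_int_add distrib_left)

lemma mult11_mult: "a \<in> mult11 \<Longrightarrow> b \<in> \<int> \<Longrightarrow> a * b \<in> mult11"
  unfolding mult11_def by (auto elim!: Ints_cases simp: mult.assoc simp flip: of_int_mult)

lemma mult11_mult': "a \<in> \<int> \<Longrightarrow> b \<in> mult11 \<Longrightarrow> a * b \<in> mult11"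
  using mult11_mult[of b a] by (simp add: mult.commute)

lemma mult11_diff: "a \<in> mult11 \<Longrightarrow> b \<in> mult11 \<Longrightarrow> a - b \<in> mult11"
  unfolding mult11_def by (auto simp flip: of_int_diff right_diff_distrib)

lemma mult11_sum: "(\<And>x. x \<in> S \<Longrightarrow> g x \<in> mult11) \<Longrightarrow> sum g S \<in> mult11"
  by (induction S rule: infinite_finite_induct) (auto intro: mult11_0 mult11_add)

lemma mult11_of_int: "11 dvd a \<Longrightarrow> of_int a \<in> mult11"
  unfolding mult11_def by auto

lemma integral_fps_1: "integral_fps 1"
  by (simp add: integral_fps_def)

lemma integral_fps_mult: "integral_fps f \<Longrightarrow> integral_fps g \<Longrightarrow> integral_fps (f * g)"
  by (auto simp: integral_fps_def fps_mult_nth intro!: Ints_sum Ints_mult)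

lemma integral_fps_power: "integral_fps f \<Longrightarrow> integral_fps (f ^ n)"
  by (induction n) (auto intro: integral_fps_1 integral_fps_mult)

lemma integral_fps_diff: "integral_fps f \<Longrightarrow> integral_fps g \<Longrightarrow> integral_fps (f - g)"
  by (auto simp: integral_fps_def)

lemma integral_fps_add: "integral_fps f \<Longrightarrow> integral_fps g \<Longrightarrow> integral_fps (f + g)"
  by (auto simp: integral_fps_def)

lemma integral_fps_prod: "(\<And>i. i \<in> S \<Longrightarrow> integral_fps (g i)) \<Longrightarrow> integral_fps (prod g S)"
  by (induction S rule: infinite_finite_induct) (auto intro: integral_fps_1 integral_fps_mult)

lemma integral_fps_X_power: "integral_fps (fps_X ^ n)"
  by (simp add: integral_fps_def fps_X_power_nth)

lemma integral_fps_euler_f: "integral_fps (euler_f r)"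
proof -
  have "integral_fps (\<Prod>i\<in>{1..n}. 1 - fps_X ^ (r * i))" for n
    by (intro integral_fps_prod integral_fps_diff integral_fps_1 integral_fps_X_power)
  then show ?thesis by (simp add: integral_fps_def euler_f_def)
qed

lemma integral_fps_inverse:
  assumes f: "integral_fps f" "f $ 0 = 1"
  shows "integral_fps (inverse f)"
  unfolding integral_fps_def
proof
  fix n
  show "inverse f $ n \<in> \<int>"
  proof (induction n rule: less_induct)
    case (less n)
    show ?case
    proof (cases "n = 0")
      case False
      have "f * inverse f = 1" using f(2) by (simp add: inverse_mult_eq_1')
      then have "(f * inverse f) $ n = 0" using False by simp
      then have "inverse f $ n = - (\<Sum>i=1..n. f $ i * inverse f $ (n - i))"
        using f(2) by (simp add: fps_mult_nth sum.atLeast_Suc_atMost)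
      also have "\<dots> \<in> \<int>"
        using less f(1) by (intro Ints_minus Ints_sum Ints_mult) (auto simp: integral_fps_def)
      finally show ?thesis .
    qed (use f in simp)
  qed
qed

definition cong11 :: "rat fps \<Rightarrow> rat fps \<Rightarrow> bool" where
  "cong11 f g \<longleftrightarrow> (\<forall>n. f $ n - g $ n \<in> mult11)"

lemma cong11_mult:
  assumes "cong11 f g" "cong11 f' g'" "integral_fps f'" "integral_fps g"
  shows "cong11 (f * f') (g * g')"
  unfolding cong11_def
proof
  fix n
  have "(f * f') $ n - (g * g') $ n =
      (\<Sum>i=0..n. (f $ i - g $ i) * f' $ (n - i) + g $ i * (f' $ (n - i) - g' $ (n - i)))"
    by (simp add: fps_mult_nth algebra_simps flip: sum_subtractf)
  also have "\<dots> \<in> mult11"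
    using assms by (intro mult11_sum mult11_add mult11_mult mult11_mult') (auto simp: cong11_def integral_fps_def)
  finally show "(f * f') $ n - (g * g') $ n \<in> mult11" .
qed

lemma cong11_refl: "cong11 f f"
  by (simp add: cong11_def mult11_0)

lemma frobenius_factor: "cong11 ((1 - fps_X ^ i) ^ 11) (1 - fps_X ^ (11 * i))"
proof -
  let ?x = "fps_X ^ i :: rat fps"
  \<comment> \<open>The coefficients are the inner signed binomial coefficients of the eleventh
    power, divided by 11.\<close>
  let ?h = "- ?x + 5 * ?x^2 - 15 * ?x^3 + 30 * ?x^4 - 42 * ?x^5 + 42 * ?x^6 - 30 * ?x^7 + 15 * ?x^8 - 5 * ?x^9 + ?x^10"
  have "(1 - x) ^ 11 = 1 - x ^ 11 + 11 * (- x + 5 * x^2 - 15 * x^3 + 30 * x^4 - 42 * x^5 + 42 * x^6 - 30 * x^7 + 15 * x^8 - 5 * x^9 + x^10)"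
    for x :: "rat fps" by algebra
  from this[of ?x] have "(1 - ?x) ^ 11 = 1 - fps_X ^ (11 * i) + 11 * ?h"
    by (simp add: mult.commute flip: power_mult)
  then have "(1 - ?x) ^ 11 = 1 - fps_X ^ (11 * i) + fps_const 11 * ?h"
    by (simp only: numeral_fps_const)
  moreover have "integral_fps ?h"
  proof -
    have "integral_fps (numeral k)" for k by (simp add: integral_fps_def numeral_fps_const)
    then show ?thesis
      by (simp only: uminus_add_conv_diff) (intro integral_fps_add integral_fps_diff integral_fps_mult integral_fps_power integral_fps_X_power; simp)
  qed
  moreover have "(11 :: rat) \<in> mult11"
    using mult11_of_int[of 11] by simp
  ultimately show ?thesis
    by (simp only: cong11_def integral_fps_def fps_add_nth fps_mult_left_const_nth add_diff_cancel_left'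
      mult11_mult simp_thms)
qed

lemma frobenius: "cong11 (euler_f 1 ^ 11) (euler_f 11)"
  unfolding cong11_def
proof
  fix n
  let ?p = "\<lambda>S. \<Prod>i\<in>S. 1 - fps_X ^ i :: rat fps"
  let ?p' = "\<lambda>S. \<Prod>i\<in>S. 1 - fps_X ^ (11 * i) :: rat fps"
  have "cong11 (?p S ^ 11) (?p' S)" for S
  proof (induction S rule: infinite_finite_induct)
    case (insert x S)
    have "cong11 ((1 - fps_X ^ x) ^ 11 * ?p S ^ 11) ((1 - fps_X ^ (11 * x)) * ?p' S)"
      by (intro cong11_mult frobenius_factor insert integral_fps_power integral_fps_prod integral_fps_diff integral_fps_1 integral_fps_X_power)
    then show ?case using insert by (simp add: power_mult_distrib)
  qed (simp_all add: cong11_refl)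
  then have "(?p {1..n} ^ 11) $ n - ?p' {1..n} $ n \<in> mult11"
    by (simp add: cong11_def)
  moreover have "agree_below (Suc n) (?p {1..n} ^ 11) (euler_f 1 ^ 11)" "agree_below (Suc n) (?p' {1..n}) (euler_f 11)"
    using euler_f_agree[of 1 n] euler_f_agree[of 11 n] by (auto intro: agree_below_power)
  ultimately show "(euler_f 1 ^ 11) $ n - euler_f 11 $ n \<in> mult11"
    by (simp add: agree_below_def)
qed

lemma sum_squares_11:
  fixes a b :: int
  assumes "11 dvd a\<^sup>2 + b\<^sup>2"
  shows "11 dvd a"
proof -
  have sq: "(a mod 11 * (a mod 11) + b mod 11 * (b mod 11)) mod 11 = 0"
  proof -
    have "(a mod 11 * (a mod 11) + b mod 11 * (b mod 11)) mod 11 = (a\<^sup>2 + b\<^sup>2) mod 11"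
      unfolding power2_eq_square by (rule mod_add_cong) (rule mod_mult_eq)+
    then show ?thesis using assms by (simp add: dvd_imp_mod_0)
  qed
  have res: "a mod 11 \<in> {0..10}" "b mod 11 \<in> {0..10}" by auto
  have "\<forall>x\<in>{0..10}. \<forall>y\<in>{0..10}. (x * x + y * y) mod 11 = 0 \<longrightarrow> x = (0 :: int)"
  proof -
    have "{0..10} = {0, 1, 2, 3, 4, 5, 6, 7, 8, 9, 10 :: int}"
      by (rule set_eqI, unfold atLeastAtMost_iff insert_iff empty_iff, presburger)
    then show ?thesis by simp
  qed
  from this[rule_format, OF res sq] have "a mod 11 = 0" .
  then show ?thesis by (rule mod_0_imp_dvd)
qed

lemma exp_series_mult11:
  assumes "\<And>k. e k = int n \<Longrightarrow> w k \<in> mult11"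
  shows "exp_series w e $ n \<in> mult11"
  unfolding exp_series_nth by (rule mult11_sum) (use assms in simp)

lemma theta_A_mult11: "(theta_A 4 ^ 2) $ (11 * n + 7) \<in> mult11"
proof -
  have p: "proper (\<lambda>j. int 4 * (3 * tri j + 2 * j))" by (rule proper_theta_A) simp
  show ?thesis
    unfolding power2_eq_square theta_A_def exp_series_mult[OF p p]
  proof (rule exp_series_mult11, clarify)
    fix j k :: int
    assume "int 4 * (3 * tri j + 2 * j) + int 4 * (3 * tri k + 2 * k) = int (11 * n + 7)"
    \<comment> \<open>A single exponent e = 6 j^2 + 2 j satisfies (6 j + 1)^2 = 6 e + 1, and 6 (11 n
      + 7) + 2 = 11 (6 n + 4).\<close>
    then have "(6 * j + 1)\<^sup>2 + (6 * k + 1)\<^sup>2 = 11 * (6 * int n + 4)"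
      using tri_double[of j] tri_double[of k] by (simp add: algebra_simps power2_eq_square)
    then have "11 dvd (6 * j + 1)\<^sup>2 + (6 * k + 1)\<^sup>2" by simp
    then have "11 dvd 6 * j + 1" by (rule sum_squares_11)
    then have "11 dvd (6 * j + 1) * (6 * k + 1)" by simp
    from mult11_of_int[OF this] show "(6 * of_int j + 1) * (6 * of_int k + 1) \<in> mult11" by simp
  qed
qed

text \<open>The index is 11 n + 6 because of the factor q in front of B^2. Here e = 6 j^2 + 4 j
  satisfies 2 (3 j + 1)^2 = 3 e + 2, and 3 (11 n + 6) + 4 = 11 (3 n + 2).\<close>

lemma theta_B_mult11: "(theta_B 2 ^ 2) $ (11 * n + 6) \<in> mult11"
proof -
  have p: "proper (\<lambda>j. int 2 * (3 * j\<^sup>2 + 2 * j))" by (rule proper_theta_B) simp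
  show ?thesis
    unfolding power2_eq_square[where 'a = "rat fps"] theta_B_def exp_series_mult[OF p p]
  proof (rule exp_series_mult11, clarify)
    fix j k :: int
    assume "int 2 * (3 * j\<^sup>2 + 2 * j) + int 2 * (3 * k\<^sup>2 + 2 * k) = int (11 * n + 6)"
    then have "2 * ((3 * j + 1)\<^sup>2 + (3 * k + 1)\<^sup>2) = 11 * (3 * int n + 2)"
      by (simp add: algebra_simps power2_eq_square)
    then have "11 dvd (3 * j + 1)\<^sup>2 + (3 * k + 1)\<^sup>2"
      by presburger
    then have "11 dvd 3 * j + 1" by (rule sum_squares_11)
    then have "11 dvd (3 * j + 1) * (3 * k + 1)" by simp
    from mult11_of_int[OF this] show "(3 * of_int j + 1) * (3 * of_int k + 1) \<in> mult11" by simp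
  qed
qed

lemma eta_quotient_mult11: "(euler_f 1 ^ 4 * euler_f 2 ^ 2) $ (11 * n + 7) \<in> mult11"
proof -
  have "(4 * fps_X * theta_B 2 ^ 2) $ (11 * n + 7) = 4 * (theta_B 2 ^ 2) $ (11 * n + 6)"
    by (simp add: mult.assoc numeral_fps_const add.commute)
  also have "\<dots> \<in> mult11"
    by (intro mult11_mult' theta_B_mult11) simp
  finally show ?thesis
    unfolding eta_quotient_dissection fps_sub_nth by (intro mult11_diff theta_A_mult11)
qed

section \<open>Removing the factor 1/f_11\<close>

lemma euler_f_nth_not_dvd:
  assumes "0 < r" "\<not> r dvd n"
  shows "euler_f r $ n = 0"
proof -
  have "\<forall>n. \<not> r dvd n \<longrightarrow> (\<Prod>i\<in>S. 1 - fps_X ^ (r * i) :: rat fps) $ n = 0" for S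
  proof (induction S rule: infinite_finite_induct)
    case (insert x S)
    show ?case
    proof (intro allI impI)
      fix n assume n: "\<not> r dvd n"
      have "\<not> r dvd n - r * x" if "r * x \<le> n"
        using n that by (metis dvd_diffD dvd_triv_left)
      with insert n show "(\<Prod>i\<in>insert x S. 1 - fps_X ^ (r * i) :: rat fps) $ n = 0"
        by (auto simp: left_diff_distrib fps_X_power_mult_nth)
    qed
  qed auto
  then show ?thesis using assms by (simp add: euler_f_def)
qed

theorem theorem3p1:
  fixes n :: nat
  shows "\<exists>m::int. d 2 (11 * n + 7) = of_int (11 * m)"
proof -
  define D where "D = euler_f 2 ^ 2 * inverse (euler_f 1 ^ 7)"
  have D: "d 2 n = D $ n" for n by (simp add: d_def D_def)
  have iD: "integral_fps D"
    unfolding D_def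
    by (intro integral_fps_mult integral_fps_power integral_fps_euler_f integral_fps_inverse) (simp add: euler_f_nth_0 fps_nth_power_0)
  have inv: "inverse (euler_f 1 ^ 7) * euler_f 1 ^ 7 = 1"
    by (intro inverse_mult_eq_1) (simp add: euler_f_nth_0 fps_nth_power_0)
  have "D * euler_f 1 ^ 11 = euler_f 2 ^ 2 * (inverse (euler_f 1 ^ 7) * euler_f 1 ^ 7) * euler_f 1 ^ 4"
    unfolding D_def by (simp add: mult.assoc flip: power_add)
  then have G: "D * euler_f 1 ^ 11 = euler_f 1 ^ 4 * euler_f 2 ^ 2"
    unfolding inv by simp
  have "cong11 (D * euler_f 1 ^ 11) (D * euler_f 11)"
    by (intro cong11_mult cong11_refl frobenius integral_fps_power integral_fps_euler_f iD)
  then have F: "(D * euler_f 11) $ (11 * n + 7) \<in> mult11" for n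
    using mult11_diff[OF eta_quotient_mult11[of n],
        of "(D * euler_f 1 ^ 11) $ (11 * n + 7) - (D * euler_f 11) $ (11 * n + 7)"]
    unfolding cong11_def G by simp
  \<comment> \<open>f_11 is a series in q^11 with constant term 1, so multiplying by it mixes only
    coefficients with index congruent to 7. Solving for the top one expresses it by the coefficient
    of D f_11 and earlier ones.\<close>
  have "D $ (11 * n + 7) \<in> mult11"
  proof (induction n rule: less_induct)
    case (less n)
    let ?N = "11 * n + 7"
    have "(euler_f 11 * D) $ ?N = D $ ?N + (\<Sum>i=1..?N. euler_f 11 $ i * D $ (?N - i))"
      by (simp add: fps_mult_nth sum.atLeast_Suc_atMost euler_f_nth_0)
    then have "D $ ?N = (D * euler_f 11) $ ?N - (\<Sum>i=1..?N. euler_f 11 $ i * D $ (?N - i))"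
      by (simp add: mult.commute)
    also have "\<dots> \<in> mult11"
    proof (intro mult11_diff F mult11_sum)
      fix i assume i: "i \<in> {1..?N}"
      show "euler_f 11 $ i * D $ (?N - i) \<in> mult11"
      proof (cases "11 dvd i")
        case True
        then obtain k where k: "i = 11 * k" by auto
        then have "k < Suc n" "0 < k" using i by auto
        then have N: "?N - i = 11 * (n - k) + 7" "n - k < n" using k by auto
        show ?thesis
          unfolding N(1) by (rule mult11_mult'[OF _ less[OF N(2)]])
            (use integral_fps_euler_f in \<open>simp add: integral_fps_def\<close>)
      qed (simp add: euler_f_nth_not_dvd mult11_0)
    qed
    finally show ?case .
  qed
  then show ?thesis
    unfolding D mult11_def by auto
qed

end
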